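(* If $f$, $g$ and $\mathcal W^{A_1,A_2}_{f,g}$ are in $L^2(\mathbb R^2,\mathbb H)$, then the inverse transform of the WVD-QOLCT is given by $$f(v)=\frac{1}{|g|_{2,Q}^2}\int_{\mathbb R^2}\int_{\mathbb R^2}\overline{K^{\lambda}_{A_1}\!\left(\tfrac{v_1+\varepsilon_1}{2},u_1\right)}\;\mathcal W^{A_1,A_2}_{f,g}\!\left(\tfrac{v+\varepsilon}{2},u\right)\;\overline{K^{\mu}_{A_2}\!\left(\tfrac{v_2+\varepsilon_2}{2},u_2\right)}\;g(\varepsilon)\,du\,d\varepsilon .$$
   Context: $\mathbb H$ is the skew field of real quaternions with conjugation $q\mapsto\overline q$ and modulus $|q|_Q=\sqrt{q\overline q}$. $\lambda,\mu\in\mathbb H$ are pure unit quaternions, i.e. $\lambda^2=\mu^2=-1$, and $e^{\lambda\theta}=\cos\theta+\lambda\sin\theta$ for $\theta\in\mathbb R$. For $f:\mathbb R^2\to\mathbb H$, $|f|_{2,Q}=\left(\int_{\mathbb R^2}|f(t)|_Q^2\,dt\right)^{1/2}$, and $L^2(\mathbb R^2,\mathbb H)$ is the space of $f$ with $|f|_{2,Q}<\infty$. Here $v=(v_1,v_2)$, $\varepsilon=(\varepsilon_1,\varepsilon_2)$, $u=(u_1,u_2)\in\mathbb R^2$; $\overline g$ denotes the function $x\mapsto\overline{g(x)}$; and $g\neq0$. For $l=1,2$, $A_l$ stands for the real parameters $(a_l,b_l,c_l,d_l,\tau_l,\eta_l)$ with $a_ld_l-b_lc_l=1$ and $b_l\neq0$.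 For $\nu\in\{\lambda,\mu\}$ the kernel is $$K^{\nu}_{A_l}(x,y)=\frac{1}{\sqrt{\nu 2\pi b_l}}\exp\!\Big(\frac{\nu}{2b_l}\big(a_lx^2-2x(y-\tau_l)-2y(d_l\tau_l-b_l\eta_l)+d_l(y^2+\tau_l^2)\big)\Big),\qquad x,y\in\mathbb R,$$ with $\frac1{\sqrt\nu}=e^{-\nu\pi/4}$. The Wigner-Ville distribution associated with the two-sided quaternionic offset linear canonical transform (WVD-QOLCT) is, for $b_1,b_2\neq0$, $$\mathcal W^{A_1,A_2}_{f,g}(t,u)=\int_{\mathbb R^2}K^{\lambda}_{A_1}(s_1,u_1)\,f\!\left(t+\tfrac s2\right)\overline{g}\!\left(t-\tfrac s2\right)\,K^{\mu}_{A_2}(s_2,u_2)\,ds,\qquad t,u\in\mathbb R^2 .$$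
   Formalization: The conjugate kernels are evaluated at v−ε instead of (v+ε)/2, since the printed formula fails for f=g=exp(−|x|²); the du-integral is taken as an L² limit over balls |u|≤R, and equality holds for almost every v. *)

theory Defs
  imports "HOL-Analysis.Analysis"
begin

section \<open>The skew field of real quaternions\<close>

datatype quat = Quat (qRe: real) (qI: real) (qJ: real) (qK: real)

lemma quat_eq_iff: "p = q \<longleftrightarrow> qRe p = qRe q \<and> qI p = qI q \<and> qJ p = qJ q \<and> qK p = qK q"
  by (cases p; cases q) simp

instantiation quat :: real_vector
begin

definition zero_quat :: quat where "0 = Quat 0 0 0 0"

definition plus_quat :: "quat \<Rightarrow> quat \<Rightarrow> quat" where
  "p + q = Quat (qRe p + qRe q) (qI p + qI q) (qJ p + qJ q) (qK p + qK q)"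

definition uminus_quat :: "quat \<Rightarrow> quat" where
  "- q = Quat (- qRe q) (- qI q) (- qJ q) (- qK q)"

definition minus_quat :: "quat \<Rightarrow> quat \<Rightarrow> quat" where
  "p - q = Quat (qRe p - qRe q) (qI p - qI q) (qJ p - qJ q) (qK p - qK q)"

definition scaleR_quat :: "real \<Rightarrow> quat \<Rightarrow> quat" where
  "r *\<^sub>R q = Quat (r * qRe q) (r * qI q) (r * qJ q) (r * qK q)"

instance
  by standard
    (simp_all add: quat_eq_iff zero_quat_def plus_quat_def uminus_quat_def minus_quat_def
      scaleR_quat_def algebra_simps)

end

lemma quat_linear_simps [simp]:
  "qRe 0 = 0" "qI 0 = 0" "qJ 0 = 0" "qK 0 = 0"
  "qRe (p + q) = qRe p + qRe q" "qI (p + q) = qI p + qI q"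
  "qJ (p + q) = qJ p + qJ q" "qK (p + q) = qK p + qK q"
  "qRe (- q) = - qRe q" "qI (- q) = - qI q" "qJ (- q) = - qJ q" "qK (- q) = - qK q"
  "qRe (p - q) = qRe p - qRe q" "qI (p - q) = qI p - qI q"
  "qJ (p - q) = qJ p - qJ q" "qK (p - q) = qK p - qK q"
  "qRe (r *\<^sub>R q) = r * qRe q" "qI (r *\<^sub>R q) = r * qI q"
  "qJ (r *\<^sub>R q) = r * qJ q" "qK (r *\<^sub>R q) = r * qK q"
  by (simp_all add: zero_quat_def plus_quat_def uminus_quat_def minus_quat_def scaleR_quat_def)

instantiation quat :: real_algebra_1
begin

definition one_quat :: quat where "1 = Quat 1 0 0 0"

definition times_quat :: "quat \<Rightarrow> quat \<Rightarrow> quat" where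
  "p * q = Quat
     (qRe p * qRe q - qI p * qI q - qJ p * qJ q - qK p * qK q)
     (qRe p * qI q + qI p * qRe q + qJ p * qK q - qK p * qJ q)
     (qRe p * qJ q - qI p * qK q + qJ p * qRe q + qK p * qI q)
     (qRe p * qK q + qI p * qJ q - qJ p * qI q + qK p * qRe q)"

instance
  by standard (simp_all add: quat_eq_iff one_quat_def times_quat_def algebra_simps)

end

lemma quat_mult_simps [simp]:
  "qRe 1 = 1" "qI 1 = 0" "qJ 1 = 0" "qK 1 = 0"
  "qRe (p * q) = qRe p * qRe q - qI p * qI q - qJ p * qJ q - qK p * qK q"
  "qI (p * q) = qRe p * qI q + qI p * qRe q + qJ p * qK q - qK p * qJ q"
  "qJ (p * q) = qRe p * qJ q - qI p * qK q + qJ p * qRe q + qK p * qI q"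
  "qK (p * q) = qRe p * qK q + qI p * qJ q - qJ p * qI q + qK p * qRe q"
  by (simp_all add: one_quat_def times_quat_def)

definition qcnj :: "quat \<Rightarrow> quat" where
  "qcnj q = Quat (qRe q) (- qI q) (- qJ q) (- qK q)"

lemma qcnj_simps [simp]:
  "qRe (qcnj q) = qRe q" "qI (qcnj q) = - qI q" "qJ (qcnj q) = - qJ q" "qK (qcnj q) = - qK q"
  by (simp_all add: qcnj_def)

instantiation quat :: real_inner
begin

definition inner_quat_def:
  "inner p q = qRe p * qRe q + qI p * qI q + qJ p * qJ q + qK p * qK q"

definition norm_quat_def:
  "norm q = sqrt ((qRe q)\<^sup>2 + (qI q)\<^sup>2 + (qJ q)\<^sup>2 + (qK q)\<^sup>2)"

definition sgn_quat_def: "sgn q = q /\<^sub>R norm q" for q :: quat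

definition dist_quat_def: "dist p q = norm (p - q)" for p q :: quat

definition uniformity_quat_def:
  "(uniformity :: (quat \<times> quat) filter) = (INF e\<in>{0<..}. principal {(x, y). dist x y < e})"

definition open_quat_def:
  "open (U :: quat set) \<longleftrightarrow> (\<forall>x\<in>U. eventually (\<lambda>(x', y). x' = x \<longrightarrow> y \<in> U) uniformity)"

instance
proof
  fix x y z :: quat and r :: real and U :: "quat set"
  show "inner x x = 0 \<longleftrightarrow> x = 0"
  proof
    assume "inner x x = 0"
    then have "(qRe x)\<^sup>2 + (qI x)\<^sup>2 + (qJ x)\<^sup>2 + (qK x)\<^sup>2 = 0"
      by (simp add: inner_quat_def power2_eq_square)
    then have "(qRe x)\<^sup>2 = 0" "(qI x)\<^sup>2 = 0" "(qJ x)\<^sup>2 = 0" "(qK x)\<^sup>2 = 0"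
      using zero_le_power2[of "qRe x"] zero_le_power2[of "qI x"]
        zero_le_power2[of "qJ x"] zero_le_power2[of "qK x"] by linarith+
    then show "x = 0" by (simp add: quat_eq_iff)
  qed (simp add: inner_quat_def)
  show "0 \<le> inner x x" by (simp add: inner_quat_def)
qed (simp_all add: inner_quat_def norm_quat_def sgn_quat_def dist_quat_def uniformity_quat_def
      open_quat_def power2_eq_square algebra_simps)

end

instantiation quat :: euclidean_space
begin

definition Basis_quat :: "quat set" where
  "Basis = {Quat 1 0 0 0, Quat 0 1 0 0, Quat 0 0 1 0, Quat 0 0 0 1}"

instance
proof
  fix u v x :: quat
  show "(Basis :: quat set) \<noteq> {}" "finite (Basis :: quat set)"
    by (simp_all add: Basis_quat_def)
  show "u \<in> Basis \<Longrightarrow> v \<in> Basis \<Longrightarrow> inner u v = (if u = v then 1 else 0)"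
    unfolding Basis_quat_def by (elim insertE emptyE) (simp_all add: inner_quat_def)
  show "(\<forall>u\<in>Basis. inner x u = 0) \<longleftrightarrow> x = 0"
    using quat_eq_iff [of x 0] by (auto simp: Basis_quat_def inner_quat_def)
qed

end

lemma norm_quat_power2:
  "(norm q)\<^sup>2 = (qRe q)\<^sup>2 + (qI q)\<^sup>2 + (qJ q)\<^sup>2 + (qK q)\<^sup>2" for q :: quat
  by (simp add: norm_quat_def)

lemma mult_qcnj: "q * qcnj q = of_real ((norm q)\<^sup>2)" "qcnj q * q = of_real ((norm q)\<^sup>2)"
  by (simp_all add: quat_eq_iff of_real_def norm_quat_power2)
    (simp_all add: power2_eq_square algebra_simps)

instantiation quat :: division_ring
begin

definition inverse_quat_def: "inverse q = qcnj q /\<^sub>R (norm q)\<^sup>2" for q :: quat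

definition divide_quat_def: "p div q = p * inverse q" for p q :: quat

instance
proof
  fix p q :: quat
  show "inverse (0::quat) = 0" by (simp add: inverse_quat_def)
  show "p div q = p * inverse q" by (simp add: divide_quat_def)
  assume "p \<noteq> 0"
  then show "inverse p * p = 1" "p * inverse p = 1"
    by (simp_all add: inverse_quat_def mult_qcnj of_real_def)
qed

end

instance quat :: real_normed_div_algebra
proof
  fix p q :: quat
  show "norm (p * q) = norm p * norm q"
    unfolding norm_quat_def real_sqrt_mult [symmetric] real_sqrt_eq_iff quat_mult_simps
    by algebra
qed

text \<open>The modulus of the paper, the square root of \<open>q * qcnj q\<close>, is the norm of the type.\<close>

lemma norm_quat_eq_sqrt_mult_qcnj: "norm q = sqrt (qRe (q * qcnj q))"
  by (simp add: norm_quat_def power2_eq_square)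


section \<open>Square integrable functions\<close>

definition in_L2 :: "('a::euclidean_space \<Rightarrow> quat) \<Rightarrow> bool" where
  "in_L2 f \<longleftrightarrow> f \<in> borel_measurable lebesgue \<and> integrable lebesgue (\<lambda>x. (norm (f x))\<^sup>2)"

definition L2_norm :: "('a::euclidean_space \<Rightarrow> quat) \<Rightarrow> real" where
  "L2_norm f = sqrt (\<integral>x. (norm (f x))\<^sup>2 \<partial>lebesgue)"

text \<open>
  For square integrable data the inner integral of a Plancherel-type inversion formula
  need not converge absolutely.  As usual for such formulas it is taken in the mean: \<open>J\<close> is
  the limit in \<open>L\<^sup>2\<close>, with respect to the parameter \<open>p\<close>, of the Lebesgue integrals of
  \<open>\<Phi> p\<close> over the balls of radius \<open>R\<close>.  The limit is unique up to a null set.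
\<close>

definition has_L2_integral ::
  "('p::euclidean_space \<Rightarrow> 'u::euclidean_space \<Rightarrow> quat) \<Rightarrow> ('p \<Rightarrow> quat) \<Rightarrow> bool" where
  "has_L2_integral \<Phi> J \<longleftrightarrow>
     in_L2 J \<and>
     (\<forall>R>0. (AE p in lebesgue. set_integrable lebesgue (cball 0 R) (\<Phi> p)) \<and>
            in_L2 (\<lambda>p. LINT u:cball 0 R|lebesgue. \<Phi> p u)) \<and>
     ((\<lambda>R. L2_norm (\<lambda>p. (LINT u:cball 0 R|lebesgue. \<Phi> p u) - J p)) \<longlongrightarrow> 0) at_top"


section \<open>The quaternionic offset linear canonical transform\<close>

record olct_param =
  pa :: real
  pb :: real
  pc :: real
  pd :: real
  ptau :: real
  peta :: real

text \<open>\<open>qcis \<nu> \<theta>\<close> is the exponential of \<open>\<nu> \<theta>\<close> when \<open>\<nu>\<close> is a pure unit quaternion.\<close>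

definition qcis :: "quat \<Rightarrow> real \<Rightarrow> quat" where
  "qcis \<nu> \<theta> = of_real (cos \<theta>) + \<nu> * of_real (sin \<theta>)"

text \<open>
  The value of \<open>1 / sqrt (\<nu> * 2 * pi * b)\<close>, with the principal square root in the complex plane
  spanned by \<open>1\<close> and \<open>\<nu>\<close>: the argument of \<open>\<nu> * b\<close> is \<open>pi / 2\<close> for \<open>b > 0\<close> and \<open>- pi / 2\<close> for
  \<open>b < 0\<close>.
\<close>

definition olct_factor :: "quat \<Rightarrow> real \<Rightarrow> quat" where
  "olct_factor \<nu> b = (1 / sqrt (2 * pi * \<bar>b\<bar>)) *\<^sub>R qcis \<nu> (- (sgn b * pi / 4))"

definition olct_kernel :: "quat \<Rightarrow> olct_param \<Rightarrow> real \<Rightarrow> real \<Rightarrow> quat" where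
  "olct_kernel \<nu> A x y =
     olct_factor \<nu> (pb A) *
     qcis \<nu> (1 / (2 * pb A) *
       (pa A * x\<^sup>2 - 2 * x * (y - ptau A) - 2 * y * (pd A * ptau A - pb A * peta A)
        + pd A * (y\<^sup>2 + (ptau A)\<^sup>2)))"

definition wvd_qolct ::
  "quat \<Rightarrow> quat \<Rightarrow> olct_param \<Rightarrow> olct_param \<Rightarrow> (real \<times> real \<Rightarrow> quat) \<Rightarrow> (real \<times> real \<Rightarrow> quat)
    \<Rightarrow> real \<times> real \<Rightarrow> real \<times> real \<Rightarrow> quat" where
  "wvd_qolct lam mu A1 A2 f g t u =
     (LINT s|lebesgue.
        olct_kernel lam A1 (fst s) (fst u) *
        f (t + (1/2) *\<^sub>R s) * qcnj (g (t - (1/2) *\<^sub>R s)) *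
        olct_kernel mu A2 (snd s) (snd u))"

text \<open>
  The integrand of the inversion formula, before multiplication by \<open>g \<epsilon>\<close>.  The product
  \<open>f v * qcnj (g \<epsilon>)\<close> is the value of \<open>f (t + s/2) * qcnj (g (t - s/2))\<close> at the midpoint
  \<open>t = (v + \<epsilon>)/2\<close> and the lag \<open>s = v - \<epsilon>\<close>, and the kernels of the transform act on the lag
  variable.  Hence the conjugate kernels are evaluated at \<open>v - \<epsilon>\<close>.  The formula as printed
  has the midpoint \<open>(v + \<epsilon>)/2\<close> in the kernels as well; this is a slip, and the formula is false
  in that form: for \<open>f v = g v = exp (- |v|\<^sup>2)\<close> all its integrals converge absolutely and its
  right-hand side is \<open>16/13 * exp (- 5/13 * |v|\<^sup>2)\<close>.
\<close>

definition wvd_inversion_integrand ::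
  "quat \<Rightarrow> quat \<Rightarrow> olct_param \<Rightarrow> olct_param \<Rightarrow> (real \<times> real \<Rightarrow> quat) \<Rightarrow> (real \<times> real \<Rightarrow> quat)
    \<Rightarrow> (real \<times> real) \<times> (real \<times> real) \<Rightarrow> real \<times> real \<Rightarrow> quat" where
  "wvd_inversion_integrand lam mu A1 A2 f g = (\<lambda>(v, \<epsilon>) u.
     qcnj (olct_kernel lam A1 (fst v - fst \<epsilon>) (fst u)) *
     wvd_qolct lam mu A1 A2 f g ((1/2) *\<^sub>R (v + \<epsilon>)) u *
     qcnj (olct_kernel mu A2 (snd v - snd \<epsilon>) (snd u)))"

end

theory Submission
  imports Defs "HOL-Probability.Characteristic_Functions"
begin

text \<open>
  For fixed \<open>t\<close> the function \<open>s \<mapsto> f (t + s/2) * qcnj (g (t - s/2))\<close> is integrable, and for almost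
  every \<open>t\<close> it is also square integrable; the distribution at \<open>t\<close> is its two-sided transform.  Up to
  unimodular factors this transform is a two-sided quaternionic Fourier transform, hence an isometry
  on integrable and square integrable functions.  The truncated inverse transform is the transform
  with the conjugate kernels of the restriction to a ball, so that the isometry property for both
  transforms, together with Fubini's theorem for the cross term, shows that the squared truncation
  error is exactly the mass of the distribution outside of the ball.  Integrated over \<open>t\<close>, this
  mass tends to \<open>0\<close>; in the coordinates \<open>v = t + s/2\<close>, \<open>\<epsilon> = t - s/2\<close>, which preserve Lebesgue
  measure, the limit of the inner integrals is therefore \<open>f v * qcnj (g \<epsilon>)\<close>.

  The isometry property follows from Gaussian regularisation.  As multiplication by unit
  quaternions from either side preserves the real inner product, the Gaussian integral of the squared
  modulus of the transform is a Gaussian average of the autocorrelation of the function, without any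
  splitting of the quaternions; the autocorrelation is continuous at \<open>0\<close> since translation is
  continuous in the mean.
\<close>

section \<open>Continuity of translation in the mean\<close>

text \<open>For \<open>M > 0\<close> this is the nearest-point projection onto the closed ball of
  radius \<open>M\<close>; the single formula with \<open>max\<close> makes continuity
  immediate.\<close>

definition clip :: "real \<Rightarrow> 'b::euclidean_space \<Rightarrow> 'b" where
  "clip M y = (M / max M (norm y)) *\<^sub>R y"

text \<open>For \<open>M \<ge> 0\<close> a continuous substitute for the indicator of a ball,
  falling linearly from 1 to 0 between the radii \<open>M\<close> and \<open>M + 1\<close>. Together
  with \<open>clip\<close> it turns continuous functions into bounded continuous functions of
  bounded support.\<close>

definition cutoff :: "real \<Rightarrow> 'a::euclidean_space \<Rightarrow> real" where
  "cutoff M x = max 0 (min 1 (M + 1 - norm x))"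

lemma cutoff_bounds: "0 \<le> cutoff M x" "cutoff M x \<le> 1"
  and cutoff_eq_1: "norm x \<le> M \<Longrightarrow> cutoff M x = 1"
  and cutoff_eq_0: "M + 1 \<le> norm x \<Longrightarrow> cutoff M x = 0"
  by (auto simp: cutoff_def)

lemma norm_clip: "M > 0 \<Longrightarrow> norm (clip M y) = M * norm y / max M (norm y)"
  by (simp add: clip_def)

lemma norm_clip_le: "M > 0 \<Longrightarrow> norm (clip M y) \<le> M"
  by (simp add: norm_clip divide_simps max_def mult_left_mono)

lemma norm_clip_le_self: "M > 0 \<Longrightarrow> norm (clip M y) \<le> norm y"
  by (auto simp: norm_clip divide_simps max_def mult_right_mono)

lemma clip_eq_self: "M > 0 \<Longrightarrow> norm y \<le> M \<Longrightarrow> clip M y = y"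
  by (simp add: clip_def max_def)

lemma continuous_on_clip [continuous_intros]:
  assumes "M > 0" "continuous_on S f"
  shows "continuous_on S (\<lambda>x. clip M (f x))"
proof -
  have "max M (norm (f x)) \<noteq> 0" for x
    using assms(1) by (auto simp: max_def)
  then show ?thesis
    unfolding clip_def using assms(2) by (auto intro!: continuous_intros)
qed

lemma continuous_on_cutoff [continuous_intros]: "continuous_on S (cutoff M)"
  unfolding cutoff_def by (intro continuous_intros)

lemma borel_measurable_clip [measurable]: "M > 0 \<Longrightarrow> clip M \<in> borel_measurable borel"
  using continuous_on_clip[of M UNIV "\<lambda>x. x"] by (auto intro: borel_measurable_continuous_onI)

lemma borel_measurable_cutoff [measurable]: "cutoff M \<in> borel_measurable borel"
  using continuous_on_cutoff[of UNIV M] by (auto intro: borel_measurable_continuous_onI)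

lemma nn_integral_lborel_shift:
  fixes f :: "'a::euclidean_space \<Rightarrow> ennreal"
  assumes [measurable]: "f \<in> borel_measurable borel"
  shows "(\<integral>\<^sup>+x. f (c + x) \<partial>lborel) = (\<integral>\<^sup>+x. f x \<partial>lborel)"
  by (subst (2) lborel_distr_plus[symmetric, of c]) (simp add: nn_integral_distr)

lemma norm_sum3_sq_le:
  fixes a b c :: "'b::real_normed_vector"
  shows "(norm (a + b + c))\<^sup>2 \<le> 3 * ((norm a)\<^sup>2 + (norm b)\<^sup>2 + (norm c)\<^sup>2)"
proof -
  have "norm (a + b + c) \<le> norm a + norm b + norm c"
    by (meson norm_triangle_ineq norm_triangle_le add_right_mono order_trans)
  then have "(norm (a + b + c))\<^sup>2 \<le> (norm a + norm b + norm c)\<^sup>2"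
    by (intro power_mono) auto
  also have "\<dots> \<le> 3 * ((norm a)\<^sup>2 + (norm b)\<^sup>2 + (norm c)\<^sup>2)"
  proof -
    have "0 \<le> (norm a - norm b)\<^sup>2 + (norm b - norm c)\<^sup>2 + (norm a - norm c)\<^sup>2" by simp
    then show ?thesis by (simp add: power2_eq_square algebra_simps)
  qed
  finally show ?thesis .
qed

text \<open>The squared distance in the mean, as an extended nonnegative integral, so that it makes
  sense before any integrability is known.\<close>

definition sq_dist :: "('a::euclidean_space \<Rightarrow> 'b::euclidean_space) \<Rightarrow> ('a \<Rightarrow> 'b) \<Rightarrow> ennreal" where
  "sq_dist f g = (\<integral>\<^sup>+x. ennreal ((norm (f x - g x))\<^sup>2) \<partial>lborel)"

text \<open>The difference \<open>h (z k + x) - h x\<close> is split through \<open>\<phi> n\<close>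
  at \<open>z k + x\<close> and at \<open>x\<close>. By translation invariance the first and the
  last piece have the same size, which is small uniformly in \<open>k\<close>.\<close>

lemma translation_continuous_closure:
  fixes h :: "'a::euclidean_space \<Rightarrow> 'b::euclidean_space"
  assumes [measurable]: "h \<in> borel_measurable borel" "\<And>n. \<phi> n \<in> borel_measurable borel"
    and conv: "(\<lambda>n. sq_dist (\<phi> n) h) \<longlonglongrightarrow> 0"
    and \<phi>: "\<And>n. (\<lambda>k. sq_dist (\<lambda>x. \<phi> n (z k + x)) (\<phi> n)) \<longlonglongrightarrow> 0"
  shows "(\<lambda>k. sq_dist (\<lambda>x. h (z k + x)) h) \<longlonglongrightarrow> 0"
proof (rule tendsto_zero_ennreal)
  fix r :: real assume "0 < r"
  \<comment> \<open>The estimate below ends with \<open>9 * e\<close>: three pieces and the factor 3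
    from \<open>norm_sum3_sq_le\<close>. The value \<open>r / 12\<close> leaves strict room.\<close>
  define e where "e = r / 12"
  have "e > 0" using \<open>0 < r\<close> by (simp add: e_def)
  have "\<forall>\<^sub>F n in sequentially. sq_dist (\<phi> n) h < ennreal e"
    using conv \<open>e > 0\<close> by (intro order_tendstoD) auto
  then obtain n where n: "sq_dist (\<phi> n) h < ennreal e"
    using eventually_happens'[OF sequentially_bot] by blast
  have "\<forall>\<^sub>F k in sequentially. sq_dist (\<lambda>x. \<phi> n (z k + x)) (\<phi> n) < ennreal e"
    using \<phi>[of n] \<open>e > 0\<close> by (intro order_tendstoD) auto
  then show "\<forall>\<^sub>F k in sequentially. sq_dist (\<lambda>x. h (z k + x)) h < ennreal r"
  proof eventually_elim
    case (elim k)
    have shift: "(\<integral>\<^sup>+x. ennreal ((norm (\<phi> n (z k + x) - h (z k + x)))\<^sup>2) \<partial>lborel) = sq_dist (\<phi> n) h"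
      unfolding sq_dist_def
      by (rule nn_integral_lborel_shift[of "\<lambda>x. ennreal ((norm (\<phi> n x - h x))\<^sup>2)"]) measurable
    have "sq_dist (\<lambda>x. h (z k + x)) h
      \<le> (\<integral>\<^sup>+x. ennreal (3 * ((norm (\<phi> n (z k + x) - h (z k + x)))\<^sup>2
          + (norm (\<phi> n (z k + x) - \<phi> n x))\<^sup>2 + (norm (\<phi> n x - h x))\<^sup>2)) \<partial>lborel)"
      unfolding sq_dist_def
    proof (intro nn_integral_mono ennreal_leI)
      fix x
      have "norm (h (z k + x) - h x) = norm ((h (z k + x) - \<phi> n (z k + x))
          + (\<phi> n (z k + x) - \<phi> n x) + (\<phi> n x - h x))"
        by simp
      then show "(norm (h (z k + x) - h x))\<^sup>2 \<le> 3 * ((norm (\<phi> n (z k + x) - h (z k + x)))\<^sup>2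
          + (norm (\<phi> n (z k + x) - \<phi> n x))\<^sup>2 + (norm (\<phi> n x - h x))\<^sup>2)"
        by (metis norm_minus_commute norm_sum3_sq_le)
    qed
    also have "\<dots> = (\<integral>\<^sup>+x. 3 * (ennreal ((norm (\<phi> n (z k + x) - h (z k + x)))\<^sup>2)
           + ennreal ((norm (\<phi> n (z k + x) - \<phi> n x))\<^sup>2) + ennreal ((norm (\<phi> n x - h x))\<^sup>2)) \<partial>lborel)"
      by (simp add: ennreal_mult ennreal_plus)
    also have "\<dots> = 3 * (sq_dist (\<phi> n) h + sq_dist (\<lambda>x. \<phi> n (z k + x)) (\<phi> n) + sq_dist (\<phi> n) h)"
      by (simp add: nn_integral_cmult nn_integral_add shift flip: sq_dist_def)
    also have "\<dots> \<le> ennreal 3 * (ennreal e + ennreal e + ennreal e)"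
      using n elim by (intro mult_mono add_mono) auto
    also have "\<dots> = ennreal (9 * e)"
      using \<open>e > 0\<close> ennreal_mult[of 3 "3 * e"] by (simp flip: ennreal_plus)
    also have "\<dots> < ennreal r"
      using \<open>0 < r\<close> by (intro ennreal_lessI) (auto simp: e_def)
    finally show ?case .
  qed
qed

lemma sets_borel_cball [measurable]: "cball a r \<in> sets borel"
  by simp

lemma finite_nn_integral_cball:
  "(\<integral>\<^sup>+x. ennreal (C * indicator (cball 0 R :: 'a::euclidean_space set) x) \<partial>lborel) < \<infinity>"
proof -
  have "emeasure lborel (cball 0 R :: 'a set) < \<infinity>"
    using emeasure_bounded_finite[OF bounded_cball] .
  then have "(\<integral>\<^sup>+x. ennreal C * indicator (cball 0 R :: 'a set) x \<partial>lborel) < \<infinity>"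
    by (simp add: nn_integral_cmult ennreal_mult_less_top)
  moreover have "ennreal (C * indicator (cball 0 R) x) = ennreal C * indicator (cball 0 R) x"
    for x :: 'a
    by (simp split: split_indicator)
  ultimately show ?thesis
    by simp
qed

text \<open>Dominated convergence: if \<open>B\<close> bounds the shifts, then all differences
  vanish outside the ball of radius \<open>R + B\<close> and are at most \<open>2 * C\<close> inside
  it.\<close>

lemma translation_continuous_continuous:
  fixes \<phi> :: "'a::euclidean_space \<Rightarrow> 'b::euclidean_space"
  assumes cont: "continuous_on UNIV \<phi>" and bd: "\<And>x. norm (\<phi> x) \<le> C"
    and supp: "\<And>x. R \<le> norm x \<Longrightarrow> \<phi> x = 0" and z: "z \<longlonglongrightarrow> 0"
  shows "(\<lambda>k. sq_dist (\<lambda>x. \<phi> (z k + x)) \<phi>) \<longlonglongrightarrow> 0"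
proof -
  have [measurable]: "\<phi> \<in> borel_measurable borel"
    using cont by (rule borel_measurable_continuous_onI)
  obtain B where B: "\<And>k. norm (z k) \<le> B"
    using z convergent_imp_Bseq Bseq_def convergentI by metis
  have C: "0 \<le> C" using bd[of 0] norm_ge_zero order_trans by blast
  have "(\<lambda>k. \<integral>\<^sup>+x. ennreal ((norm (\<phi> (z k + x) - \<phi> x))\<^sup>2) \<partial>lborel) \<longlonglongrightarrow> (\<integral>\<^sup>+(x::'a). 0 \<partial>lborel)"
  proof (rule nn_integral_dominated_convergence)
    let ?w = "\<lambda>x::'a. ennreal ((2 * C)\<^sup>2 * indicator (cball 0 (R + B)) x)"
    show "(\<integral>\<^sup>+x. ?w x \<partial>lborel) < \<infinity>"
      by (rule finite_nn_integral_cball)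
    show "AE x in lborel. ennreal ((norm (\<phi> (z k + x) - \<phi> x))\<^sup>2) \<le> ?w x" for k
    proof (rule AE_I2)
      fix x :: 'a
      show "ennreal ((norm (\<phi> (z k + x) - \<phi> x))\<^sup>2) \<le> ?w x"
      proof (cases "norm x \<le> R + B")
        case True
        have "norm (\<phi> (z k + x) - \<phi> x) \<le> 2 * C"
          using bd[of "z k + x"] bd[of x] norm_triangle_ineq4[of "\<phi> (z k + x)" "\<phi> x"] by linarith
        then have "(norm (\<phi> (z k + x) - \<phi> x))\<^sup>2 \<le> (2 * C)\<^sup>2"
          by (intro power_mono) auto
        then show ?thesis using True by (auto intro!: ennreal_leI)
      next
        case False
        have "norm (z k + x) \<ge> norm x - norm (z k)" by (simp add: norm_diff_ineq add.commute)
        then have "\<phi> (z k + x) = 0" using False B[of k] by (intro supp) auto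
        moreover have "\<phi> x = 0"
          using False B[of k] norm_ge_zero[of "z k"] by (intro supp) linarith
        ultimately show ?thesis by simp
      qed
    qed
    show "AE x in lborel. (\<lambda>k. ennreal ((norm (\<phi> (z k + x) - \<phi> x))\<^sup>2)) \<longlonglongrightarrow> 0"
    proof (rule AE_I2)
      fix x :: 'a
      have "(\<lambda>k. z k + x) \<longlonglongrightarrow> 0 + x" by (intro tendsto_intros z)
      then have "(\<lambda>k. \<phi> (z k + x)) \<longlonglongrightarrow> \<phi> x"
        using continuous_on_tendsto_compose[OF cont] by auto
      then have "(\<lambda>k. (norm (\<phi> (z k + x) - \<phi> x))\<^sup>2) \<longlonglongrightarrow> (norm (\<phi> x - \<phi> x))\<^sup>2"
        by (intro tendsto_intros)
      then show "(\<lambda>k. ennreal ((norm (\<phi> (z k + x) - \<phi> x))\<^sup>2)) \<longlonglongrightarrow> 0"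
        using tendsto_ennrealI by fastforce
    qed
  qed measurable
  then show ?thesis by (simp add: sq_dist_def)
qed

text \<open>Approximation in two stages: truncated continuous functions \<open>\<phi> M n\<close>
  tend to the truncation \<open>hM M\<close> as \<open>n\<close> grows, and \<open>hM M\<close>
  tends to \<open>h\<close> as \<open>M\<close> grows. Continuity of translation survives both
  limits.\<close>

theorem L2_translation_continuous:
  fixes h :: "'a::euclidean_space \<Rightarrow> 'b::euclidean_space"
  assumes h[measurable]: "h \<in> borel_measurable borel"
    and fin: "(\<integral>\<^sup>+x. ennreal ((norm (h x))\<^sup>2) \<partial>lborel) < \<infinity>"
    and z: "z \<longlonglongrightarrow> 0"
  shows "(\<lambda>k. sq_dist (\<lambda>x. h (z k + x)) h) \<longlonglongrightarrow> 0"
proof -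
  \<comment> \<open>This form of measurability supplies continuous functions converging to
    \<open>h\<close> off a negligible set. Nothing is known about their size, hence the truncations
    that follow.\<close>
  have "h measurable_on UNIV"
    using measurable_completion[of h lborel borel] by (intro lebesgue_measurable_imp_measurable_on) auto
  then obtain N g where N: "negligible N" and g: "\<And>n. continuous_on UNIV (g n)"
    and lim: "\<And>x. x \<notin> N \<Longrightarrow> (\<lambda>n. g n x) \<longlonglongrightarrow> h x"
    unfolding measurable_on_def by auto
  have [measurable]: "g n \<in> borel_measurable borel" for n
    using g by (rule borel_measurable_continuous_onI)
  \<comment> \<open>The same truncation is applied to the approximants and to \<open>h\<close>: for
    fixed \<open>M\<close> all functions share one bound and one supporting ball, which gives the
    domination in \<open>n\<close>.\<close>
  define \<phi> where "\<phi> M n x = cutoff (real (Suc M)) x *\<^sub>R clip (real (Suc M)) (g n x)" for M n x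
  define hM where "hM M x = cutoff (real (Suc M)) x *\<^sub>R clip (real (Suc M)) (h x)" for M x
  have [measurable]: "\<phi> M n \<in> borel_measurable borel" for M n
    unfolding \<phi>_def by measurable
  have [measurable]: "hM M \<in> borel_measurable borel" for M
    unfolding hM_def by measurable
  have trans\<phi>: "(\<lambda>k. sq_dist (\<lambda>x. \<phi> M n (z k + x)) (\<phi> M n)) \<longlonglongrightarrow> 0" for M n
  proof (rule translation_continuous_continuous[OF _ _ _ z])
    show "continuous_on UNIV (\<phi> M n)"
      unfolding \<phi>_def by (intro continuous_intros g) auto
    show "norm (\<phi> M n x) \<le> real (Suc M)" for x
      using mult_mono[OF cutoff_bounds(2)[of "real (Suc M)" x] norm_clip_le[of "real (Suc M)" "g n x"]]
        cutoff_bounds(1)[of "real (Suc M)" x]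
      by (simp add: \<phi>_def)
    show "real (Suc M) + 1 \<le> norm x \<Longrightarrow> \<phi> M n x = 0" for x
      by (simp add: \<phi>_def cutoff_eq_0)
  qed
  have AEN: "AE x in lborel. x \<notin> N"
    using N by (metis AE_not_in AE_completion_iff negligible_iff_null_sets)
  have conv\<phi>: "(\<lambda>n. sq_dist (\<phi> M n) (hM M)) \<longlonglongrightarrow> 0" for M
  proof -
    let ?M = "real (Suc M)"
    have "(\<lambda>n. \<integral>\<^sup>+x. ennreal ((norm (\<phi> M n x - hM M x))\<^sup>2) \<partial>lborel) \<longlonglongrightarrow> (\<integral>\<^sup>+(x::'a). 0 \<partial>lborel)"
    proof (rule nn_integral_dominated_convergence)
      let ?w = "\<lambda>x::'a. ennreal ((2 * ?M)\<^sup>2 * indicator (cball 0 (?M + 1)) x)"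
      show "(\<integral>\<^sup>+x. ?w x \<partial>lborel) < \<infinity>"
        by (rule finite_nn_integral_cball)
      show "AE x in lborel. ennreal ((norm (\<phi> M n x - hM M x))\<^sup>2) \<le> ?w x" for n
      proof (rule AE_I2)
        fix x :: 'a
        show "ennreal ((norm (\<phi> M n x - hM M x))\<^sup>2) \<le> ?w x"
        proof (cases "norm x \<le> ?M + 1")
          case True
          have *: "norm (clip ?M y) \<le> ?M" for y :: 'b by (rule norm_clip_le) auto
          have "norm (\<phi> M n x - hM M x) = cutoff ?M x * norm (clip ?M (g n x) - clip ?M (h x))"
            by (simp add: \<phi>_def hM_def cutoff_bounds(1) flip: scaleR_diff_right)
          also have "\<dots> \<le> 1 * (2 * ?M)"
            using *[of "g n x"] *[of "h x"] norm_triangle_ineq4[of "clip ?M (g n x)" "clip ?M (h x)"]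
            by (intro mult_mono cutoff_bounds) simp_all
          finally have "(norm (\<phi> M n x - hM M x))\<^sup>2 \<le> (2 * ?M)\<^sup>2"
            by (intro power_mono) auto
          then show ?thesis using True by (auto intro!: ennreal_leI)
        next
          case False
          then show ?thesis by (simp add: \<phi>_def hM_def cutoff_eq_0)
        qed
      qed
      show "AE x in lborel. (\<lambda>n. ennreal ((norm (\<phi> M n x - hM M x))\<^sup>2)) \<longlonglongrightarrow> 0"
        using AEN
      proof eventually_elim
        case (elim x)
        have "continuous_on UNIV (clip ?M :: 'b \<Rightarrow> 'b)"
          using continuous_on_clip[of ?M UNIV "\<lambda>x. x"] by auto
        then have "(\<lambda>n. clip ?M (g n x)) \<longlonglongrightarrow> clip ?M (h x)"
          by (rule continuous_on_tendsto_compose[OF _ lim[OF elim]]) auto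
        then have "(\<lambda>n. (norm (\<phi> M n x - hM M x))\<^sup>2) \<longlonglongrightarrow> (norm (hM M x - hM M x))\<^sup>2"
          unfolding \<phi>_def hM_def by (intro tendsto_intros)
        then show "(\<lambda>k. ennreal ((norm (\<phi> M k x - hM M x))\<^sup>2)) \<longlonglongrightarrow> 0"
          using tendsto_ennrealI by fastforce
      qed
    qed measurable
    then show ?thesis by (simp add: sq_dist_def)
  qed
  have hM_le: "norm (hM M x) \<le> norm (h x)" for M x
    using mult_mono[OF cutoff_bounds(2)[of "real (Suc M)" x] norm_clip_le_self[of "real (Suc M)" "h x"]]
      cutoff_bounds(1)[of "real (Suc M)" x]
    by (simp add: hM_def)
  have conv: "(\<lambda>M. sq_dist (hM M) h) \<longlonglongrightarrow> 0"
  proof -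
    have "(\<lambda>M. \<integral>\<^sup>+x. ennreal ((norm (hM M x - h x))\<^sup>2) \<partial>lborel) \<longlonglongrightarrow> (\<integral>\<^sup>+(x::'a). 0 \<partial>lborel)"
    proof (rule nn_integral_dominated_convergence)
      let ?w = "\<lambda>x. 4 * ennreal ((norm (h x))\<^sup>2)"
      show "(\<integral>\<^sup>+x. ?w x \<partial>lborel) < \<infinity>"
        using fin by (simp add: nn_integral_cmult ennreal_mult_less_top)
      show "AE x in lborel. ennreal ((norm (hM M x - h x))\<^sup>2) \<le> ?w x" for M
      proof (rule AE_I2)
        fix x :: 'a
        have "norm (hM M x - h x) \<le> 2 * norm (h x)"
          using hM_le[of M x] norm_triangle_ineq4[of "hM M x" "h x"] by linarith
        then have "(norm (hM M x - h x))\<^sup>2 \<le> (2 * norm (h x))\<^sup>2"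
          by (intro power_mono) auto
        then have "ennreal ((norm (hM M x - h x))\<^sup>2) \<le> ennreal (4 * (norm (h x))\<^sup>2)"
          by (intro ennreal_leI) (simp add: power_mult_distrib)
        then show "ennreal ((norm (hM M x - h x))\<^sup>2) \<le> ?w x"
          by (simp add: ennreal_mult)
      qed
      show "AE x in lborel. (\<lambda>M. ennreal ((norm (hM M x - h x))\<^sup>2)) \<longlonglongrightarrow> 0"
      proof (rule AE_I2)
        fix x :: 'a
        obtain m :: nat where m: "max (norm x) (norm (h x)) \<le> real m"
          using real_arch_simple by blast
        \<comment> \<open>At a fixed point the truncation is inactive as soon as \<open>M\<close>
          exceeds both \<open>norm x\<close> and \<open>norm (h x)\<close>.\<close>
        have "\<forall>\<^sub>F M in sequentially. ennreal ((norm (hM M x - h x))\<^sup>2) = 0"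
          using eventually_ge_at_top[of m]
        proof eventually_elim
          case (elim M)
          then have "real m \<le> real M" by simp
          then show ?case
            using m by (simp add: hM_def cutoff_eq_1 clip_eq_self)
        qed
        then show "(\<lambda>M. ennreal ((norm (hM M x - h x))\<^sup>2)) \<longlonglongrightarrow> 0"
          by (rule tendsto_eventually)
      qed
    qed measurable
    then show ?thesis by (simp add: sq_dist_def)
  qed
  \<comment> \<open>The closure lemma is used twice, innermost for the limit in \<open>n\<close> and
    outermost for the limit in \<open>M\<close>.\<close>
  show ?thesis
  proof (rule translation_continuous_closure[OF _ _ conv])
    show "(\<lambda>k. sq_dist (\<lambda>x. hM M (z k + x)) (hM M)) \<longlonglongrightarrow> 0" for M
      by (rule translation_continuous_closure[OF _ _ conv\<phi> trans\<phi>]) measurable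
  qed measurable
qed

section \<open>Quaternionic exponentials and Gaussian integrals\<close>

text \<open>Multiplicativity of the norm gives modulus 1; subtracting the real part of
  \<open>\<nu> * \<nu>\<close> from this leaves only the square of the real part, which must
  vanish.\<close>

lemma pure_unit_quat:
  assumes "\<nu>\<^sup>2 = (-1 :: quat)"
  shows "\<nu> * \<nu> = -1" "qRe \<nu> = 0" "(qI \<nu>)\<^sup>2 + (qJ \<nu>)\<^sup>2 + (qK \<nu>)\<^sup>2 = 1"
proof -
  show *: "\<nu> * \<nu> = -1" using assms by (simp add: power2_eq_square)
  have "(norm \<nu>)\<^sup>2 = norm (\<nu> * \<nu>)" by (simp add: power2_eq_square norm_mult)
  also have "\<dots> = 1" unfolding * by simp
  finally have 1: "(qRe \<nu>)\<^sup>2 + (qI \<nu>)\<^sup>2 + (qJ \<nu>)\<^sup>2 + (qK \<nu>)\<^sup>2 = 1"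
    by (simp add: norm_quat_power2)
  have "qRe (\<nu> * \<nu>) = -1" unfolding * by simp
  then have "(qRe \<nu>)\<^sup>2 - (qI \<nu>)\<^sup>2 - (qJ \<nu>)\<^sup>2 - (qK \<nu>)\<^sup>2 = -1"
    by (simp add: power2_eq_square)
  with 1 have "(qRe \<nu>)\<^sup>2 = 0" by linarith
  then show "qRe \<nu> = 0" by simp
  with 1 show "(qI \<nu>)\<^sup>2 + (qJ \<nu>)\<^sup>2 + (qK \<nu>)\<^sup>2 = 1" by simp
qed

lemma qcis_scaleR: "qcis \<nu> \<theta> = cos \<theta> *\<^sub>R 1 + sin \<theta> *\<^sub>R \<nu>"
  by (simp add: qcis_def of_real_def)

lemma qcis_add:
  assumes "\<nu>\<^sup>2 = -1"
  shows "qcis \<nu> (a + b) = qcis \<nu> a * qcis \<nu> b"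
  unfolding qcis_scaleR cos_add sin_add
  by (simp add: algebra_simps pure_unit_quat(1)[OF assms])

lemma qcnj_qcis:
  assumes "\<nu>\<^sup>2 = -1"
  shows "qcnj (qcis \<nu> a) = qcis \<nu> (- a)"
  using pure_unit_quat(2)[OF assms] by (simp add: qcis_scaleR quat_eq_iff)

lemma norm_qcis:
  assumes "\<nu>\<^sup>2 = -1"
  shows "norm (qcis \<nu> a) = 1"
proof -
  have "(norm (qcis \<nu> a))\<^sup>2 = (cos a)\<^sup>2 + (sin a)\<^sup>2 * ((qI \<nu>)\<^sup>2 + (qJ \<nu>)\<^sup>2 + (qK \<nu>)\<^sup>2)"
    using pure_unit_quat(2)[OF assms]
    by (simp add: norm_quat_power2 qcis_scaleR power_mult_distrib algebra_simps)
  then have "(norm (qcis \<nu> a))\<^sup>2 = 1"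
    unfolding pure_unit_quat(3)[OF assms] by simp
  then have "norm (qcis \<nu> a) = 1 \<or> norm (qcis \<nu> a) = -1"
    by (simp add: power2_eq_1_iff)
  then show ?thesis
    using norm_ge_zero[of "qcis \<nu> a"] by linarith
qed

lemma qcnj_scaleR [simp]: "qcnj (r *\<^sub>R q) = r *\<^sub>R qcnj q"
  by (simp add: quat_eq_iff)

lemma norm_qcnj [simp]: "norm (qcnj q) = norm q"
  by (simp add: norm_quat_def)

text \<open>The adjoint of left multiplication is left multiplication by the conjugate, and likewise
  on the right. These two rules move kernels across the real inner product without any
  commutation.\<close>

lemma inner_mult_left_quat: "inner (p * a) b = inner a (qcnj p * b)" for p a b :: quat
  by (simp add: inner_quat_def algebra_simps)

lemma inner_mult_right_quat: "inner (a * p) b = inner a (b * qcnj p)" for p a b :: quat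
  by (simp add: inner_quat_def algebra_simps)

lemma borel_measurable_qcis [measurable]: "qcis \<nu> \<in> borel_measurable borel"
  unfolding qcis_scaleR[abs_def] by measurable

lemma bounded_linear_qcnj: "bounded_linear qcnj"
  by (rule bounded_linear_intro[where K=1]) (simp_all add: quat_eq_iff)

lemma borel_measurable_qcnj [measurable]: "qcnj \<in> borel_measurable borel"
  by (intro borel_measurable_continuous_onI linear_continuous_on bounded_linear_qcnj)

lemma borel_measurable_fst [measurable]:
    "fst \<in> borel_measurable (borel :: ('a::topological_space \<times> 'b::topological_space) measure)"
  and borel_measurable_snd [measurable]:
    "snd \<in> borel_measurable (borel :: ('a::topological_space \<times> 'b::topological_space) measure)"
  by (intro borel_measurable_continuous_onI continuous_intros)+

declare borel_measurable_Pair [measurable (raw)]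

section \<open>Gaussian weights and their quaternionic Fourier integrals\<close>

definition gaussian :: "real \<Rightarrow> real" where "gaussian x = exp (- x\<^sup>2 / 2)"

lemma borel_measurable_gaussian [measurable]: "gaussian \<in> borel_measurable borel"
  unfolding gaussian_def by measurable

lemma gaussian_pos: "0 < gaussian x" and gaussian_le_1: "gaussian x \<le> 1"
  by (simp_all add: gaussian_def)

lemma gaussian_std_normal: "gaussian x = sqrt (2 * pi) * std_normal_density x"
  by (simp add: gaussian_def std_normal_density_def)

lemma integrable_gaussian: "integrable lborel gaussian"
  and integral_gaussian: "(LINT x|lborel. gaussian x) = sqrt (2 * pi)"
  unfolding gaussian_std_normal[abs_def]
    using integrable_normal_density[of 1 0] integral_normal_density[of 1 0] by auto

lemma integrable_gaussian_scaled:
  assumes "c \<noteq> 0" shows "integrable lborel (\<lambda>x. gaussian (x / c))"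
  using lborel_integrable_real_affine[OF integrable_gaussian, of "1/c" 0] assms by simp

text \<open>Real and imaginary part of the characteristic function of the standard normal
  distribution, rescaled by \<open>sqrt (2 * pi)\<close>.\<close>

lemma gaussian_cos: "(LINT x|lborel. gaussian x * cos (t * x)) = sqrt (2 * pi) * gaussian t"
  and gaussian_sin: "(LINT x|lborel. gaussian x * sin (t * x)) = 0"
proof -
  have [measurable]: "iexp \<in> borel_measurable borel"
    by (intro borel_measurable_continuous_onI continuous_intros)
  have int: "integrable lborel (\<lambda>x. std_normal_density x *\<^sub>R iexp (t * x))"
    by (rule Bochner_Integration.integrable_bound[OF integrable_normal_density[of 1 0]]) auto
  have "(LINT x|lborel. std_normal_density x *\<^sub>R iexp (t * x)) = char std_normal_distribution t"
    unfolding char_def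
    by (subst integral_density) (auto simp: normal_density_nonneg)
  also have "\<dots> = complex_of_real (gaussian t)"
    by (simp add: char_std_normal_distribution gaussian_def)
  finally have *: "(LINT x|lborel. std_normal_density x *\<^sub>R iexp (t * x))
      = complex_of_real (gaussian t)" .
  have "(LINT x|lborel. std_normal_density x * cos (t * x)) = gaussian t"
    using arg_cong[OF *, of Re] integral_Re[OF int] by (simp add: Re_exp)
  then show "(LINT x|lborel. gaussian x * cos (t * x)) = sqrt (2 * pi) * gaussian t"
    by (simp add: gaussian_std_normal[of x for x] mult.assoc)
  have "(LINT x|lborel. std_normal_density x * sin (t * x)) = 0"
    using arg_cong[OF *, of Im] integral_Im[OF int] by (simp add: Im_exp)
  then show "(LINT x|lborel. gaussian x * sin (t * x)) = 0"
    by (simp add: gaussian_std_normal[of x for x] mult.assoc)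
qed

lemma integrable_gaussian_qcis:
  assumes "\<nu>\<^sup>2 = -1" "c \<noteq> 0"
  shows "integrable lborel (\<lambda>x. gaussian (x / c) *\<^sub>R qcis \<nu> (t * x))"
  by (rule Bochner_Integration.integrable_bound[OF integrable_gaussian_scaled[OF assms(2)]])
    (auto simp: norm_qcis[OF assms(1)])

text \<open>The sine part integrates to 0, so the value is real. It therefore commutes with every
  quaternion, which the two-sided version exploits.\<close>

lemma integral_gaussian_qcis:
  assumes \<nu>: "\<nu>\<^sup>2 = -1" and c: "c > 0"
  shows "(LINT x|lborel. gaussian (x / c) *\<^sub>R qcis \<nu> (t * x))
      = (c * sqrt (2 * pi) * gaussian (c * t)) *\<^sub>R 1"
proof -
  have cos: "integrable lborel (\<lambda>x. gaussian x * cos (s * x))"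
    and sin: "integrable lborel (\<lambda>x. gaussian x * sin (s * x))" for s
    by (rule Bochner_Integration.integrable_bound[OF integrable_gaussian];
        auto simp: abs_mult mult_le_cancel_left1 gaussian_pos less_imp_le abs_of_pos)+
  have "(LINT x|lborel. gaussian (x / c) *\<^sub>R qcis \<nu> (t * x))
      = \<bar>c\<bar> *\<^sub>R (LINT x|lborel. gaussian ((0 + c * x) / c) *\<^sub>R qcis \<nu> (t * (0 + c * x)))"
    using c by (intro lborel_integral_real_affine) auto
  also have "\<dots> = c *\<^sub>R (LINT x|lborel. (gaussian x * cos ((c * t) * x)) *\<^sub>R 1
      + (gaussian x * sin ((c * t) * x)) *\<^sub>R \<nu>)"
    using c by (simp add: qcis_scaleR scaleR_add_right mult_ac)
  also have "\<dots> = (c * sqrt (2 * pi) * gaussian (c * t)) *\<^sub>R 1"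
    by (subst Bochner_Integration.integral_add) (auto simp: cos sin gaussian_cos gaussian_sin)
  finally show ?thesis .
qed

lemma integrable_prod_mult:
  fixes f :: "'a::euclidean_space \<Rightarrow> real" and g :: "'b::euclidean_space \<Rightarrow> real"
  assumes f: "integrable lborel f" and g: "integrable lborel g"
  shows "integrable lborel (\<lambda>x. f (fst x) * g (snd x))"
proof -
  have [measurable]: "f \<in> borel_measurable borel" "g \<in> borel_measurable borel"
    using borel_measurable_integrable[OF f] borel_measurable_integrable[OF g] by auto
  have "integrable (lborel \<Otimes>\<^sub>M lborel) (\<lambda>x. f (fst x) * g (snd x))"
  proof (rule lborel_pair.Fubini_integrable)
    have "integrable lborel (\<lambda>x. norm (f x) * (LINT y|lborel. norm (g y)))"
      using f by (intro integrable_mult_left integrable_norm)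
    then show "integrable lborel (\<lambda>x. LINT y|lborel. norm (f (fst (x, y)) * g (snd (x, y))))"
      by (simp add: abs_mult)
    show "AE x in lborel. integrable lborel (\<lambda>y. f (fst (x, y)) * g (snd (x, y)))"
      using g by auto
  qed measurable
  then show ?thesis by (simp add: lborel_prod)
qed

text \<open>The parameter \<open>c\<close> is the width: for positive \<open>c\<close> tending to
  infinity the weight increases to 1.\<close>

definition gaussian2 :: "real \<Rightarrow> real \<times> real \<Rightarrow> real" where
  "gaussian2 c u = gaussian (fst u / c) * gaussian (snd u / c)"

lemma borel_measurable_gaussian2 [measurable]: "gaussian2 c \<in> borel_measurable borel"
  unfolding gaussian2_def by measurable

lemma gaussian2_pos: "0 < gaussian2 c u"
  by (simp add: gaussian2_def gaussian_pos)

lemma integrable_gaussian2: "c \<noteq> 0 \<Longrightarrow> integrable lborel (gaussian2 c)"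
  unfolding gaussian2_def
  using integrable_prod_mult[OF integrable_gaussian_scaled integrable_gaussian_scaled] by blast

lemma integral_lborel_prod:
  fixes f :: "'a::euclidean_space \<times> 'b::euclidean_space \<Rightarrow> 'c::{banach, second_countable_topology}"
  assumes "integrable lborel f"
  shows "(LINT x|lborel. f x) = (LINT x|lborel. LINT y|lborel. f (x, y))"
  using lborel_pair.integral_fst'[of f] assms by (simp add: lborel_prod)

lemma integral_gaussian2:
  assumes "c > 0"
  shows "(LINT u|lborel. gaussian2 c u) = 2 * pi * c\<^sup>2"
proof -
  have *: "(LINT x|lborel. gaussian (x / c)) = c * sqrt (2 * pi)"
    using lborel_integral_real_affine[of c "\<lambda>x. gaussian (x / c)" 0] assms
      by (simp add: integral_gaussian)
  show ?thesis
    using assms by (subst integral_lborel_prod)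
      (auto simp: integrable_gaussian2 gaussian2_def * power2_eq_square algebra_simps)
qed

lemma integrable_gaussian2_qcis:
  assumes "lam\<^sup>2 = -1" "mu\<^sup>2 = -1" "c \<noteq> 0"
  shows "integrable lborel (\<lambda>u. gaussian2 c u *\<^sub>R (qcis lam (a * fst u) * q * qcis mu (b * snd u)))"
  by (rule Bochner_Integration.integrable_bound[where f="\<lambda>u. gaussian2 c u * norm q"])
    (auto simp: norm_mult norm_qcis assms integrable_gaussian2 intro!: integrable_mult_left)

text \<open>Fubini separates a left and a right one-dimensional factor around \<open>q\<close>; both
  are real, so \<open>q\<close> comes out unchanged up to a scalar.\<close>

lemma integral_gaussian2_qcis:
  assumes lam: "lam\<^sup>2 = -1" and mu: "mu\<^sup>2 = -1" and c: "c > 0"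
  shows "(LINT u|lborel. gaussian2 c u *\<^sub>R (qcis lam (a * fst u) * q * qcis mu (b * snd u)))
       = (2 * pi * c\<^sup>2 * (gaussian (c * a) * gaussian (c * b))) *\<^sub>R q"
proof -
  have "(LINT u|lborel. gaussian2 c u *\<^sub>R (qcis lam (a * fst u) * q * qcis mu (b * snd u)))
    = (LINT x|lborel. LINT y|lborel. gaussian2 c (x, y) *\<^sub>R (qcis lam (a * x) * q * qcis mu (b * y)))"
    using c by (subst integral_lborel_prod[OF integrable_gaussian2_qcis[OF lam mu]]) auto
  also have "\<dots> = (LINT x|lborel. LINT y|lborel. (gaussian (x / c) *\<^sub>R qcis lam (a * x))
      * (q * (gaussian (y / c) *\<^sub>R qcis mu (b * y))))"
    by (simp add: gaussian2_def mult_ac)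
  also have "\<dots> = (LINT x|lborel. gaussian (x / c) *\<^sub>R qcis lam (a * x))
      * (q * (LINT y|lborel. gaussian (y / c) *\<^sub>R qcis mu (b * y)))"
    using c by (simp add: integrable_gaussian_qcis lam mu del: mult_scaleR_left mult_scaleR_right)
  also have "\<dots> = (2 * pi * c\<^sup>2 * (gaussian (c * a) * gaussian (c * b))) *\<^sub>R q"
    by (simp add: integral_gaussian_qcis[OF lam c] integral_gaussian_qcis[OF mu c] power2_eq_square)
  finally show ?thesis .
qed

lemma integral_lborel_scale2:
  fixes f :: "real \<times> real \<Rightarrow> real"
  assumes [measurable]: "f \<in> borel_measurable borel" and "a \<noteq> 0" "b \<noteq> 0"
  shows "(LINT z|lborel. f z) = \<bar>a * b\<bar> * (LINT w|lborel. f (a * fst w, b * snd w))"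
proof -
  \<comment> \<open>The diagonal entries of the scaling, indexed by \<open>Basis\<close>, whose only
    elements are \<open>(1, 0)\<close> and \<open>(0, 1)\<close>.\<close>
  define c where "c j = (if j = (1, 0) then a else b)" for j :: "real \<times> real"
  have B: "(Basis :: (real \<times> real) set) = {(1, 0), (0, 1)}"
    by (auto simp: Basis_prod_def)
  have T: "0 + (\<Sum>j\<in>Basis. (c j * inner w j) *\<^sub>R j) = (a * fst w, b * snd w)" for w
    unfolding B by (simp add: c_def inner_prod_def)
  have P: "(\<Prod>j\<in>Basis. \<bar>c j\<bar>) = \<bar>a * b\<bar>"
    unfolding B by (simp add: c_def abs_mult)
  have "lborel = density (distr lborel borel (\<lambda>w. (a * fst w, b * snd w))) (\<lambda>_. ennreal \<bar>a * b\<bar>)"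
    using lborel_affine_euclidean[of c 0] assms(2,3) unfolding T P by (auto simp: c_def)
  then have "(LINT z|lborel. f z) = (LINT z|density
      (distr lborel borel (\<lambda>w. (a * fst w, b * snd w))) (\<lambda>_. ennreal \<bar>a * b\<bar>). f z)"
    by simp
  also have "\<dots> = \<bar>a * b\<bar> * (LINT w|lborel. f (a * fst w, b * snd w))"
    by (subst integral_density) (auto simp: integral_distr)
  finally show ?thesis .
qed

section \<open>Plancherel for the two-sided quaternionic Fourier transform\<close>

text \<open>The scales \<open>p1\<close> and \<open>p2\<close> will be the coefficients of the
  bilinear phase: \<open>- 1 / b\<close> for the transform kernels and the opposite sign for their
  conjugates.\<close>

definition qft :: "quat \<Rightarrow> quat \<Rightarrow> real \<Rightarrow> real \<Rightarrow> (real \<times> real \<Rightarrow> quat) \<Rightarrow> real \<times> real \<Rightarrow> quat" where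
  "qft lam mu p1 p2 h u =
     (LINT x|lborel. qcis lam (p1 * fst x * fst u) * h x * qcis mu (p2 * snd x * snd u))"

text \<open>The exponentials of the second argument are carried over to the first by the adjoint
  rules, each on its own side, where they merge with exponentials of the same axis. Only phase
  differences survive.\<close>

lemma inner_qcis_qcis:
  assumes lam: "lam\<^sup>2 = -1" and mu: "mu\<^sup>2 = -1"
  shows "inner (qcis lam a * q * qcis mu b) (qcis lam a' * q' * qcis mu b')
    = inner (qcis lam (a - a') * q * qcis mu (b - b')) q'"
proof -
  have "inner (qcis lam a * q * qcis mu b) (qcis lam a' * q' * qcis mu b')
      = inner (qcis lam a * q * qcis mu b * qcis mu (- b')) (qcis lam a' * q')"
    by (metis inner_commute inner_mult_right_quat qcnj_qcis[OF mu])
  also have "\<dots> = inner (qcis lam (- a') * (qcis lam a * q * qcis mu b * qcis mu (- b'))) q'"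
    by (metis inner_commute inner_mult_left_quat qcnj_qcis[OF lam])
  also have "\<dots> = inner (qcis lam (- a' + a) * q * qcis mu (b + - b')) q'"
    by (simp only: qcis_add[OF lam, of "- a'" a] qcis_add[OF mu, of b "- b'"] mult.assoc)
  finally show ?thesis by simp
qed

section \<open>The transform of an integrable function\<close>

context
  fixes lam mu :: quat and p1 p2 :: real and h :: "real \<times> real \<Rightarrow> quat"
  assumes lam: "lam\<^sup>2 = -1" and mu: "mu\<^sup>2 = -1"
    and h1: "integrable lborel h"
begin

private lemma hmeas [measurable]: "h \<in> borel_measurable borel"
  using borel_measurable_integrable[OF h1] by simp

private definition E where
  "E x u = qcis lam (p1 * fst x * fst u) * h x * qcis mu (p2 * snd x * snd u)"

private lemma Emeas [measurable]: "(\<lambda>z. E (f z) (g z)) \<in> borel_measurable M"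
  if [measurable]: "f \<in> borel_measurable M" "g \<in> borel_measurable M"
  unfolding E_def by measurable

private lemma normE: "norm (E x u) = norm (h x)"
  by (simp add: E_def norm_mult norm_qcis lam mu)

private lemma intE: "integrable lborel (\<lambda>x. E x u)"
  by (rule Bochner_Integration.integrable_bound[OF h1]) (auto simp: normE)

private lemma int_hh: "integrable lborel (\<lambda>z. norm (h (fst z)) * norm (h (snd z)))"
  using integrable_prod_mult[OF integrable_norm[OF h1] integrable_norm[OF h1]] .

text \<open>An inner product of two integrals is a double integral of inner products, absolutely
  convergent since \<open>h\<close> is integrable.\<close>

private lemma norm_qft_sq:
  "(norm (qft lam mu p1 p2 h u))\<^sup>2 = (LINT z|lborel. inner (E (fst z) u) (E (snd z) u))"
proof -
  have F: "qft lam mu p1 p2 h u = (LINT x|lborel. E x u)"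
    by (simp add: qft_def E_def)
  have int: "integrable lborel (\<lambda>z. inner (E (fst z) u) (E (snd z) u))"
    by (rule Bochner_Integration.integrable_bound[OF int_hh])
      (auto simp: normE intro!: order_trans[OF Cauchy_Schwarz_ineq2])
  have "(LINT z|lborel. inner (E (fst z) u) (E (snd z) u))
      = (LINT x|lborel. LINT y|lborel. inner (E x u) (E y u))"
    by (subst integral_lborel_prod[OF int]) simp
  also have "\<dots> = (LINT x|lborel. inner (E x u) (LINT y|lborel. E y u))"
    by (simp add: intE)
  also have "\<dots> = inner (LINT x|lborel. E x u) (LINT y|lborel. E y u)"
    by (simp add: intE)
  finally show ?thesis by (simp add: F power2_norm_eq_inner)
qed

lemma qft_measurable [measurable]: "qft lam mu p1 p2 h \<in> borel_measurable borel"
proof -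
  have "(\<lambda>u. LINT x|lborel. E x u) \<in> borel_measurable (lborel :: (real \<times> real) measure)"
    by (rule lborel.borel_measurable_lebesgue_integral) (simp add: split_beta lborel_prod)
  then show ?thesis by (simp add: qft_def[abs_def] E_def)
qed

lemma norm_qft_le: "norm (qft lam mu p1 p2 h u) \<le> (LINT x|lborel. norm (h x))"
proof -
  have "norm (LINT x|lborel. E x u) \<le> (LINT x|lborel. norm (E x u))"
    by (rule integral_norm_bound)
  then show ?thesis by (simp add: normE qft_def flip: E_def)
qed

section \<open>Gaussian regularisation by means of the autocorrelation\<close>

context
  assumes p: "p1 \<noteq> 0" "p2 \<noteq> 0" and h2: "integrable lborel (\<lambda>x. (norm (h x))\<^sup>2)"
begin

private definition autocorr where "autocorr z = (LINT x|lborel. inner (h (z + x)) (h x))"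

private lemma shift_h2: "integrable lborel (\<lambda>x. (norm (h (z + x)))\<^sup>2)"
proof -
  have "integrable (distr lborel borel ((+) z)) (\<lambda>x. (norm (h x))\<^sup>2)"
    using h2 by (simp add: lborel_distr_plus)
  then show ?thesis by (subst (asm) integrable_distr_eq) auto
qed

private lemma integral_shift_h2: "(LINT x|lborel. (norm (h (z + x)))\<^sup>2)
    = (LINT x|lborel. (norm (h x))\<^sup>2)"
proof -
  have "(LINT x|lborel. (norm (h x))\<^sup>2) = (LINT x|distr lborel borel ((+) z). (norm (h x))\<^sup>2)"
    by (simp add: lborel_distr_plus)
  also have "\<dots> = (LINT x|lborel. (norm (h (z + x)))\<^sup>2)"
    by (subst integral_distr) auto
  finally show ?thesis by simp
qed

private lemma int_corr: "integrable lborel (\<lambda>x. inner (h (z + x)) (h x))"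
proof (rule Bochner_Integration.integrable_bound[OF
  Bochner_Integration.integrable_add[OF shift_h2[of z] h2]])
  show "AE x in lborel. norm (inner (h (z + x)) (h x)) \<le> norm ((norm (h (z + x)))\<^sup>2 + (norm (h x))\<^sup>2)"
  proof (rule AE_I2)
    fix x
    have "\<bar>inner (h (z + x)) (h x)\<bar> \<le> norm (h (z + x)) * norm (h x)"
      by (rule Cauchy_Schwarz_ineq2)
    also have "\<dots> \<le> (norm (h (z + x)))\<^sup>2 + (norm (h x))\<^sup>2"
    proof -
      have "2 * (norm (h (z + x)) * norm (h x)) \<le> (norm (h (z + x)))\<^sup>2 + (norm (h x))\<^sup>2"
        using sum_squares_bound[of "norm (h (z + x))" "norm (h x)"] by simp
      moreover have "0 \<le> norm (h (z + x)) * norm (h x)" by simp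
      ultimately show ?thesis by linarith
    qed
    finally show "norm (inner (h (z + x)) (h x)) \<le> norm ((norm (h (z + x)))\<^sup>2 + (norm (h x))\<^sup>2)"
      by simp
  qed
qed measurable

private definition N where "N = (LINT x|lborel. (norm (h x))\<^sup>2)"

text \<open>Polarisation together with translation invariance of the norm. Continuity of the
  autocorrelation at 0 thereby becomes continuity of translation in the mean.\<close>

private lemma autocorr_eq: "autocorr z = N - (1/2) * (LINT x|lborel. (norm (h (z + x) - h x))\<^sup>2)"
  and int_diff: "integrable lborel (\<lambda>x. (norm (h (z + x) - h x))\<^sup>2)"
proof -
  have eq: "(norm (h (z + x) - h x))\<^sup>2 = (norm (h (z + x)))\<^sup>2 + (norm (h x))\<^sup>2 - 2
      * inner (h (z + x)) (h x)" for x
    unfolding power2_norm_eq_inner by (simp add: inner_commute algebra_simps)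
  show "integrable lborel (\<lambda>x. (norm (h (z + x) - h x))\<^sup>2)"
    unfolding eq by (intro Bochner_Integration.integrable_diff Bochner_Integration.integrable_add
        integrable_mult_right shift_h2 h2 int_corr)
  show "autocorr z = N - (1/2) * (LINT x|lborel. (norm (h (z + x) - h x))\<^sup>2)"
    unfolding eq autocorr_def N_def by (simp add: shift_h2 h2 int_corr integral_shift_h2,
      simp add: field_simps)
qed

private lemma autocorr_tendsto: "z \<longlonglongrightarrow> 0 \<Longrightarrow> (\<lambda>k. autocorr (z k)) \<longlonglongrightarrow> N"
proof -
  assume z: "z \<longlonglongrightarrow> 0"
  have fin: "(\<integral>\<^sup>+x. ennreal ((norm (h x))\<^sup>2) \<partial>lborel) < \<infinity>"
    using h2 by (simp add: nn_integral_eq_integral)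
  have eq: "sq_dist (\<lambda>x. h (z k + x)) h = ennreal (LINT x|lborel. (norm (h (z k + x) - h x))\<^sup>2)" for k
    unfolding sq_dist_def by (rule nn_integral_eq_integral[OF int_diff]) simp
  have "(\<lambda>k. ennreal (LINT x|lborel. (norm (h (z k + x) - h x))\<^sup>2)) \<longlonglongrightarrow> ennreal 0"
    using L2_translation_continuous[OF hmeas fin z] by (simp add: eq)
  then have "(\<lambda>k. LINT x|lborel. (norm (h (z k + x) - h x))\<^sup>2) \<longlonglongrightarrow> 0"
    by (subst (asm) tendsto_ennreal_iff) auto
  then have "(\<lambda>k. N - (1/2) * (LINT x|lborel. (norm (h (z k + x) - h x))\<^sup>2)) \<longlonglongrightarrow> N - (1/2) * 0"
    by (intro tendsto_intros)
  then show ?thesis by (simp add: autocorr_eq)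
qed

text \<open>The inequality of the means and translation invariance. The absolute value stays inside
  the integral because the bound also has to justify Fubini in \<open>weighted\<close>.\<close>

private lemma corr_abs_le: "(LINT x|lborel. \<bar>inner (h (z + x)) (h x)\<bar>) \<le> N"
proof -
  have "\<bar>inner (h (z + x)) (h x)\<bar> \<le> (1/2) * ((norm (h (z + x)))\<^sup>2 + (norm (h x))\<^sup>2)" for x
    using Cauchy_Schwarz_ineq2[of "h (z + x)" "h x"]
      sum_squares_bound[of "norm (h (z + x))" "norm (h x)"]
    by simp
  then have "(LINT x|lborel. \<bar>inner (h (z + x)) (h x)\<bar>)
      \<le> (LINT x|lborel. (1/2) * ((norm (h (z + x)))\<^sup>2 + (norm (h x))\<^sup>2))"
    by (intro integral_mono integrable_mult_right Bochner_Integration.integrable_add shift_h2 h2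
        integrable_abs int_corr)
  also have "\<dots> = N"
    by (simp add: shift_h2 h2 integral_shift_h2 N_def)
  finally show ?thesis .
qed

private lemma autocorr_bound: "\<bar>autocorr z\<bar> \<le> N"
  unfolding autocorr_def
  using integral_abs_bound[of lborel "\<lambda>x. inner (h (z + x)) (h x)"] corr_abs_le[of z] by linarith

private lemma autocorr_meas [measurable]: "autocorr \<in> borel_measurable borel"
proof -
  have [measurable]: "(\<lambda>w. inner (h (fst w + snd w)) (h (snd w)))
      \<in> borel_measurable (borel :: ((real \<times> real) \<times> (real \<times> real)) measure)"
    by measurable
  have "(\<lambda>z. LINT x|lborel. inner (h (z + x)) (h x))
      \<in> borel_measurable (lborel :: (real \<times> real) measure)"
    by (rule lborel.borel_measurable_lebesgue_integral) (simp add: split_beta lborel_prod)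
  then show ?thesis unfolding autocorr_def[abs_def] by simp
qed

text \<open>The squared modulus is expanded as a double integral and the integration over
  \<open>u\<close> is done first, which leaves a Gaussian in the difference of the two points.
  Integrating over all pairs with a given difference produces the autocorrelation, and rescaling the
  difference moves the dependence on \<open>c\<close> into its argument.\<close>

private lemma weighted:
  assumes c: "c > 0"
  shows "(LINT u|lborel. gaussian2 c u * (norm (qft lam mu p1 p2 h u))\<^sup>2)
    = 2 * pi / \<bar>p1 * p2\<bar> * (LINT w|lborel. gaussian2 1 w
      * autocorr (fst w / (c * p1), snd w / (c * p2)))"
proof -
  let ?k = "\<lambda>z. gaussian (c * (p1 * fst z)) * gaussian (c * (p2 * snd z))"
  let ?G = "\<lambda>(u :: real \<times> real) (z :: (real \<times> real) \<times> (real \<times> real)). gaussian2 c u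
      * inner (E (fst z) u) (E (snd z) u)"
  have bnd: "integrable lborel (\<lambda>w. gaussian2 c (fst w)
      * (norm (h (fst (snd w))) * norm (h (snd (snd w)))))"
    using integrable_prod_mult[OF integrable_gaussian2 int_hh] c by simp
  have int: "integrable (lborel \<Otimes>\<^sub>M lborel) (\<lambda>(u, z). ?G u z)"
    unfolding lborel_prod
    by (rule Bochner_Integration.integrable_bound[OF bnd])
      (auto simp: normE split_beta abs_mult gaussian2_pos abs_of_pos intro!: mult_left_mono
        order_trans[OF Cauchy_Schwarz_ineq2] less_imp_le[OF gaussian2_pos])
  \<comment> \<open>By \<open>inner_qcis_qcis\<close> the phases are linear in \<open>u\<close> with
    the coordinate differences as frequencies, so the explicit Gaussian integral applies.\<close>
  have inner_int: "(LINT u|lborel. ?G u z)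
      = 2 * pi * c\<^sup>2 * (?k (fst z - snd z) * inner (h (fst z)) (h (snd z)))" for z
  proof -
    let ?a = "p1 * fst (fst z - snd z)" and ?b = "p2 * snd (fst z - snd z)"
    have "(LINT u|lborel. ?G u z) = (LINT u|lborel. inner
        (gaussian2 c u *\<^sub>R (qcis lam (?a * fst u) * h (fst z) * qcis mu (?b * snd u))) (h (snd z)))"
      by (simp only: E_def inner_qcis_qcis[OF lam mu]) (simp add: algebra_simps)
    also have "\<dots> = inner ((2 * pi * c\<^sup>2 * (gaussian (c * ?a) * gaussian (c * ?b))) *\<^sub>R h (fst z))
        (h (snd z))"
      by (subst integral_inner_left[OF integrable_gaussian2_qcis[OF lam mu]])
        (use c in \<open>auto simp: integral_gaussian2_qcis[OF lam mu c]\<close>)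
    finally show ?thesis by simp
  qed
  have int_k: "integrable lborel (\<lambda>z. ?k (fst z - snd z) * inner (h (fst z)) (h (snd z)))"
    by (rule Bochner_Integration.integrable_bound[OF int_hh])
      (auto simp: abs_mult gaussian_pos abs_of_pos gaussian_le_1 less_imp_le intro!: mult_le_one
        mult_left_le_one_le
        order_trans[OF mult_left_le_one_le[OF abs_ge_zero]] Cauchy_Schwarz_ineq2)
  have "(LINT u|lborel. gaussian2 c u * (norm (qft lam mu p1 p2 h u))\<^sup>2)
      = (LINT u|lborel. LINT z|lborel. ?G u z)"
    by (simp add: norm_qft_sq)
  also have "\<dots> = (LINT z|lborel. LINT u|lborel. ?G u z)"
    by (rule lborel_pair.Fubini_integral[OF int, symmetric])
  also have "\<dots> = 2 * pi * c\<^sup>2 * (LINT z|lborel. ?k (fst z - snd z) * inner (h (fst z)) (h (snd z)))"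
    by (simp add: inner_int)
  also have "(LINT z|lborel. ?k (fst z - snd z) * inner (h (fst z)) (h (snd z)))
      = (LINT z|lborel. ?k z * autocorr z)"
  proof -
    have int_k': "integrable (lborel \<Otimes>\<^sub>M lborel) (\<lambda>(x, y). ?k (x - y) * inner (h x) (h y))"
      using int_k by (simp add: lborel_prod case_prod_unfold)
    have kint: "integrable lborel ?k"
    proof -
      have "integrable lborel (\<lambda>x. gaussian (c * (q * x)))" if "q \<noteq> 0" for q
        using integrable_gaussian_scaled[of "1 / (c * q)"] that c by (simp add: mult_ac)
      from integrable_prod_mult[OF this[OF p(1)] this[OF p(2)]] show ?thesis .
    qed
    \<comment> \<open>Absolute integrability in the new variables: for each \<open>z\<close> the
      integral over \<open>y\<close> is at most \<open>N\<close> times an integrable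
      Gaussian.\<close>
    have int_s: "integrable (lborel \<Otimes>\<^sub>M lborel) (\<lambda>(z, y). ?k z * inner (h (z + y)) (h y))"
    proof (rule lborel_pair.Fubini_integrable)
      have m: "(\<lambda>z. LINT y|lborel. \<bar>inner (h (z + y)) (h y)\<bar>)
          \<in> borel_measurable (lborel :: (real \<times> real) measure)"
        by (rule lborel.borel_measurable_lebesgue_integral) (simp add: split_beta lborel_prod)
      have "integrable lborel (\<lambda>z. ?k z * N)"
        using kint by (rule integrable_mult_left)
      then show "integrable lborel (\<lambda>z. LINT y|lborel. norm
          (case (z, y) of (z, y) \<Rightarrow> ?k z * inner (h (z + y)) (h y)))"
      proof (rule Bochner_Integration.integrable_bound)
        show "(\<lambda>z. LINT y|lborel. norm (case (z, y) of (z, y) \<Rightarrow> ?k z * inner (h (z + y)) (h y)))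
            \<in> borel_measurable lborel"
          using m by (simp add: abs_mult)
        show "AE z in lborel. norm (LINT y|lborel. norm
            (case (z, y) of (z, y) \<Rightarrow> ?k z * inner (h (z + y)) (h y))) \<le> norm (?k z * N)"
        proof (rule AE_I2)
          fix z :: "real \<times> real"
          note corr_abs_le[of z]
          then show "norm (LINT y|lborel. norm
              (case (z, y) of (z, y) \<Rightarrow> ?k z * inner (h (z + y)) (h y))) \<le> norm (?k z * N)"
            using gaussian_pos by (auto simp: abs_mult abs_of_pos intro!: mult_left_mono abs_leI)
        qed
      qed
      show "AE z in lborel. integrable lborel
          (\<lambda>y. case (z, y) of (z, y) \<Rightarrow> ?k z * inner (h (z + y)) (h y))"
        by (auto intro!: AE_I2 int_corr)
    qed (simp add: split_beta lborel_prod)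
    have "(LINT z|lborel. ?k (fst z - snd z) * inner (h (fst z)) (h (snd z)))
        = (LINT y|lborel. LINT x|lborel. ?k (x - y) * inner (h x) (h y))"
      using lborel_pair.integral_snd[OF int_k'] by (simp add: case_prod_unfold lborel_prod)
    \<comment> \<open>For fixed \<open>y\<close> the substitution is the translation
      \<open>x = y + z\<close>.\<close>
    also have "\<dots> = (LINT y|lborel. LINT z|lborel. ?k z * inner (h (z + y)) (h y))"
    proof (rule Bochner_Integration.integral_cong[OF refl])
      fix y :: "real \<times> real"
      have "(LINT x|lborel. ?k (x - y) * inner (h x) (h y))
          = (LINT x|distr lborel borel ((+) y). ?k (x - y) * inner (h x) (h y))"
        by (simp add: lborel_distr_plus)
      also have "\<dots> = (LINT z|lborel. ?k z * inner (h (z + y)) (h y))"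
        by (subst integral_distr) (auto simp: add.commute)
      finally show "(LINT x|lborel. ?k (x - y) * inner (h x) (h y))
          = (LINT z|lborel. ?k z * inner (h (z + y)) (h y))" .
    qed
    also have "\<dots> = (LINT z|lborel. LINT y|lborel. ?k z * inner (h (z + y)) (h y))"
      by (rule lborel_pair.Fubini_integral[OF int_s])
    finally show ?thesis by (simp add: autocorr_def)
  qed
  \<comment> \<open>Normalising the Gaussian to width 1; the Jacobian contributes the inverse square
    of \<open>c\<close>, which cancels the factor \<open>c\<^sup>2\<close> from the integration over
    \<open>u\<close>.\<close>
  also have "\<dots> = \<bar>1 / (c * p1) * (1 / (c * p2))\<bar>
      * (LINT w|lborel. gaussian2 1 w * autocorr (fst w / (c * p1), snd w / (c * p2)))"
    using c p by (subst integral_lborel_scale2[of _ "1 / (c * p1)" "1 / (c * p2)"])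
      (auto simp: gaussian2_def)
  finally show ?thesis
    using c by (simp add: abs_mult power2_eq_square field_simps)
qed

text \<open>The width in \<open>weighted\<close> is sent to infinity along \<open>c = n + 1\<close>.
  The left side converges monotonically; on the right the autocorrelation is sampled ever closer to
  0, where it tends to \<open>N\<close>. The integral on the left is an extended one because its
  finiteness is part of the claim.\<close>

theorem qft_plancherel:
  "(\<integral>\<^sup>+u. ennreal ((norm (qft lam mu p1 p2 h u))\<^sup>2) \<partial>lborel)
     = ennreal (4 * pi\<^sup>2 / \<bar>p1 * p2\<bar> * (LINT x|lborel. (norm (h x))\<^sup>2))"
proof (rule LIMSEQ_unique)
  let ?F = "\<lambda>u. (norm (qft lam mu p1 p2 h u))\<^sup>2"
  have lim0: "(\<lambda>n. a / real (Suc n)) \<longlonglongrightarrow> 0" for a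
    using tendsto_mult[OF LIMSEQ_inverse_real_of_nat tendsto_const[of a]] by (simp add: field_simps)
  have lim1: "(\<lambda>n. gaussian2 (real (Suc n)) u) \<longlonglongrightarrow> 1" for u
  proof -
    have "(\<lambda>n. gaussian (a / real (Suc n))) \<longlonglongrightarrow> exp (- 0\<^sup>2 / 2)" for a
      unfolding gaussian_def by (intro tendsto_intros lim0) simp
    then have "(\<lambda>n. gaussian2 (real (Suc n)) u) \<longlonglongrightarrow> exp (- 0\<^sup>2 / 2) * exp (- 0\<^sup>2 / 2)"
      unfolding gaussian2_def by (intro tendsto_mult)
    then show ?thesis by simp
  qed
  show "(\<lambda>n. \<integral>\<^sup>+u. ennreal (gaussian2 (real (Suc n)) u * ?F u) \<partial>lborel)
      \<longlonglongrightarrow> (\<integral>\<^sup>+u. ennreal (?F u) \<partial>lborel)"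
  proof (rule nn_integral_LIMSEQ)
    show "incseq (\<lambda>n u. ennreal (gaussian2 (real (Suc n)) u * ?F u))"
    proof (intro incseq_SucI le_funI ennreal_leI mult_right_mono)
      fix n u
      have "gaussian (a / real (Suc n)) \<le> gaussian (a / real (Suc (Suc n)))" for a
      proof -
        have "\<bar>a / real (Suc (Suc n))\<bar> \<le> \<bar>a / real (Suc n)\<bar>"
          unfolding abs_divide by (intro divide_left_mono) auto
        then show ?thesis
          unfolding gaussian_def by (simp only: abs_le_square_iff) simp
      qed
      then show "gaussian2 (real (Suc n)) u \<le> gaussian2 (real (Suc (Suc n))) u"
        unfolding gaussian2_def by (intro mult_mono less_imp_le[OF gaussian_pos])
    qed simp
    show "(\<lambda>n. ennreal (gaussian2 (real (Suc n)) u * ?F u)) \<longlonglongrightarrow> ennreal (?F u)" for u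
      using tendsto_mult[OF lim1[of u] tendsto_const[of "?F u"]] by (intro tendsto_ennrealI) simp
  qed measurable
  \<comment> \<open>At fixed width the transform is bounded by the integral of
    \<open>norm (h x)\<close>, so the weighted integral is finite and the real identity
    \<open>weighted\<close> can be used.\<close>
  have eq: "(\<integral>\<^sup>+u. ennreal (gaussian2 (real (Suc n)) u * ?F u) \<partial>lborel)
    = ennreal (2 * pi / \<bar>p1 * p2\<bar> * (LINT w|lborel. gaussian2 1 w
      * autocorr (fst w / (real (Suc n) * p1), snd w / (real (Suc n) * p2))))" for n
  proof -
    have "integrable lborel (\<lambda>u. gaussian2 (real (Suc n)) u * ?F u)"
    proof (rule Bochner_Integration.integrable_bound)
      show "integrable lborel (\<lambda>u. gaussian2 (real (Suc n)) u * (LINT x|lborel. norm (h x))\<^sup>2)"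
        by (intro integrable_mult_left integrable_gaussian2) simp
      show "AE u in lborel. norm (gaussian2 (real (Suc n)) u * ?F u)
          \<le> norm (gaussian2 (real (Suc n)) u * (LINT x|lborel. norm (h x))\<^sup>2)"
        using norm_qft_le by (auto simp: abs_mult intro!: mult_left_mono power_mono)
    qed measurable
    then have "(\<integral>\<^sup>+u. ennreal (gaussian2 (real (Suc n)) u * ?F u) \<partial>lborel)
        = ennreal (LINT u|lborel. gaussian2 (real (Suc n)) u * ?F u)"
      by (intro nn_integral_eq_integral) (auto simp: less_imp_le[OF gaussian2_pos])
    then show ?thesis by (simp add: weighted)
  qed
  have "(\<lambda>n. LINT w|lborel. gaussian2 1 w
      * autocorr (fst w / (real (Suc n) * p1), snd w / (real (Suc n) * p2)))
        \<longlonglongrightarrow> (LINT w|lborel. gaussian2 1 w * N)"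
  proof (rule integral_dominated_convergence[where w = "\<lambda>w. gaussian2 1 w * N"])
    show "integrable lborel (\<lambda>w. gaussian2 1 w * N)"
      by (intro integrable_mult_left integrable_gaussian2) simp
    show "AE w in lborel. norm (gaussian2 1 w
        * autocorr (fst w / (real (Suc n) * p1), snd w / (real (Suc n) * p2)))
          \<le> gaussian2 1 w * N" for n
      using autocorr_bound by (auto simp: abs_mult gaussian2_pos abs_of_pos intro!: mult_left_mono
        less_imp_le[OF gaussian2_pos])
    show "AE w in lborel. (\<lambda>n. gaussian2 1 w
        * autocorr (fst w / (real (Suc n) * p1), snd w / (real (Suc n) * p2))) \<longlonglongrightarrow> gaussian2 1 w * N"
    proof (rule AE_I2)
      fix w :: "real \<times> real"
      have 0: "(\<lambda>n. a / (real (Suc n) * q)) \<longlonglongrightarrow> 0" for a q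
        using tendsto_mult[OF LIMSEQ_inverse_real_of_nat tendsto_const[of "a / q"]]
        by (simp add: field_simps)
      have "(\<lambda>n. (fst w / (real (Suc n) * p1), snd w / (real (Suc n) * p2))) \<longlonglongrightarrow> (0, 0)"
        by (intro tendsto_Pair 0)
      then have "(\<lambda>n. autocorr (fst w / (real (Suc n) * p1), snd w / (real (Suc n) * p2))) \<longlonglongrightarrow> N"
        by (intro autocorr_tendsto) (simp add: zero_prod_def)
      then show "(\<lambda>n. gaussian2 1 w * autocorr
          (fst w / (real (Suc n) * p1), snd w / (real (Suc n) * p2))) \<longlonglongrightarrow> gaussian2 1 w * N"
        by (intro tendsto_intros)
    qed
  qed measurable
  then have "(\<lambda>n. ennreal (2 * pi / \<bar>p1 * p2\<bar>
      * (LINT w|lborel. gaussian2 1 w * autocorr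
        (fst w / (real (Suc n) * p1), snd w / (real (Suc n) * p2)))))
      \<longlonglongrightarrow> ennreal (2 * pi / \<bar>p1 * p2\<bar> * (LINT w|lborel. gaussian2 1 w * N))"
    by (intro tendsto_ennrealI tendsto_intros)
  then show "(\<lambda>n. \<integral>\<^sup>+u. ennreal (gaussian2 (real (Suc n)) u * ?F u) \<partial>lborel) \<longlonglongrightarrow>
      ennreal (4 * pi\<^sup>2 / \<bar>p1 * p2\<bar> * (LINT x|lborel. (norm (h x))\<^sup>2))"
    \<comment> \<open>The total mass \<open>2 * pi\<close> of \<open>gaussian2 1\<close> supplies
      the second factor \<open>2 * pi\<close> of the constant.\<close>
    unfolding eq by (simp add: integral_gaussian2 N_def power2_eq_square mult_ac)
qed

end

end

section \<open>Two-sided transforms with chirp kernels\<close>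

text \<open>The phase consists of a part in \<open>x\<close>, a part in \<open>y\<close> and a
  bilinear part; only the last one mixes the variables. The modulus is the normalisation that makes
  the resulting two-sided transform an isometry.\<close>

definition chirp :: "quat \<Rightarrow> real \<Rightarrow> (real \<Rightarrow> real) \<Rightarrow> (real \<Rightarrow> real) \<Rightarrow> real \<Rightarrow> real \<Rightarrow> quat" where
  "chirp \<nu> p \<alpha> \<beta> x y = sqrt (\<bar>p\<bar> / (2 * pi)) *\<^sub>R qcis \<nu> (\<alpha> x + \<beta> y + p * x * y)"

text \<open>Hiding the two one-variable phases gives a class that contains the transform kernels and
  is closed under conjugation with exchange of the arguments.\<close>

definition is_chirp :: "quat \<Rightarrow> real \<Rightarrow> (real \<Rightarrow> real \<Rightarrow> quat) \<Rightarrow> bool" where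
  "is_chirp \<nu> p K \<longleftrightarrow> (\<exists>\<alpha>\<in>borel_measurable borel. \<exists>\<beta>\<in>borel_measurable borel. K = chirp \<nu> p \<alpha> \<beta>)"

text \<open>The bilinear term of the exponent is \<open>- x * y / b\<close>. The constant phase of
  the square root factor, including its dependence on the sign of \<open>b\<close>, is absorbed into
  the part in \<open>y\<close>.\<close>

lemma is_chirp_olct_kernel:
  assumes "\<nu>\<^sup>2 = -1" "pb A \<noteq> 0"
  shows "is_chirp \<nu> (- 1 / pb A) (olct_kernel \<nu> A)"
proof -
  let ?\<alpha> = "\<lambda>x. (pa A * x\<^sup>2 + 2 * x * ptau A) / (2 * pb A)"
  let ?\<beta> = "\<lambda>y. (- 2 * y * (pd A * ptau A - pb A * peta A) + pd A * (y\<^sup>2 + (ptau A)\<^sup>2)) / (2 * pb A)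
      - sgn (pb A) * pi / 4"
  have "olct_kernel \<nu> A x y = chirp \<nu> (- 1 / pb A) ?\<alpha> ?\<beta> x y" for x y
  proof -
    have 1: "1 / sqrt (2 * pi * \<bar>pb A\<bar>) = sqrt (\<bar>- 1 / pb A\<bar> / (2 * pi))"
      by (simp add: real_sqrt_divide real_sqrt_mult)
    have 2: "?\<alpha> x + ?\<beta> y + - 1 / pb A * x * y = - (sgn (pb A) * pi / 4) + 1 / (2 * pb A) *
       (pa A * x\<^sup>2 - 2 * x * (y - ptau A) - 2 * y * (pd A * ptau A - pb A * peta A)
        + pd A * (y\<^sup>2 + (ptau A)\<^sup>2))"
      using assms(2) by (simp add: field_simps)
    show ?thesis
      unfolding olct_kernel_def olct_factor_def chirp_def 1 2 qcis_add[OF assms(1)] by simp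
  qed
  then have "olct_kernel \<nu> A = chirp \<nu> (- 1 / pb A) ?\<alpha> ?\<beta>" by (intro ext)
  then show ?thesis unfolding is_chirp_def by (intro bexI[of _ ?\<alpha>] bexI[of _ ?\<beta>]) auto
qed

text \<open>Conjugation negates every phase. Consequently the inverse transform is covered by the
  same isometry result as the forward one.\<close>

lemma is_chirp_adjoint:
  assumes "\<nu>\<^sup>2 = -1" "is_chirp \<nu> p K"
  shows "is_chirp \<nu> (- p) (\<lambda>y x. qcnj (K x y))"
proof -
  obtain \<alpha> \<beta> where [measurable]: "\<alpha> \<in> borel_measurable borel" "\<beta> \<in> borel_measurable borel"
    and K: "K = chirp \<nu> p \<alpha> \<beta>"
    using assms(2) by (auto simp: is_chirp_def)
  have "(\<lambda>y x. qcnj (K x y)) = chirp \<nu> (- p) (\<lambda>y. - \<beta> y) (\<lambda>x. - \<alpha> x)"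
    by (intro ext) (simp add: K chirp_def qcnj_qcis[OF assms(1)] algebra_simps)
  then show ?thesis unfolding is_chirp_def by (intro bexI[of _ "\<lambda>y. - \<beta> y"] bexI[of _ "\<lambda>x. - \<alpha> x"]) auto
qed

lemma norm_chirp:
  assumes "\<nu>\<^sup>2 = -1" "is_chirp \<nu> p K"
  shows "norm (K x y) = sqrt (\<bar>p\<bar> / (2 * pi))"
  using assms(2) by (auto simp: is_chirp_def chirp_def norm_qcis[OF assms(1)])

lemma chirp_measurable:
  assumes "is_chirp \<nu> p K"
    and [measurable]: "f \<in> borel_measurable M" "g \<in> borel_measurable M"
  shows "(\<lambda>z. K (f z) (g z)) \<in> borel_measurable M"
proof -
  obtain \<alpha> \<beta> where [measurable]: "\<alpha> \<in> borel_measurable borel" "\<beta> \<in> borel_measurable borel"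
    and K: "K = chirp \<nu> p \<alpha> \<beta>"
    using assms(1) by (auto simp: is_chirp_def)
  show ?thesis unfolding K chirp_def by measurable
qed

definition two_sided ::
  "(real \<Rightarrow> real \<Rightarrow> quat) \<Rightarrow> (real \<Rightarrow> real \<Rightarrow> quat) \<Rightarrow> (real \<times> real \<Rightarrow> quat) \<Rightarrow> real \<times> real \<Rightarrow> quat" where
  "two_sided K1 K2 h y = (LINT x|lborel. K1 (fst x) (fst y) * h x * K2 (snd x) (snd y))"

text \<open>The phases in the integration variable are absorbed into \<open>h\<close>, giving
  \<open>h'\<close> with the same modulus; the phases in the other variable come out as unimodular
  factors. What remains is \<open>qft\<close>, multiplied by the product \<open>s\<close> of the
  moduli of the two kernels.\<close>

lemma two_sided_chirp:
  assumes lam: "lam\<^sup>2 = -1" and mu: "mu\<^sup>2 = -1"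
    and K: "is_chirp lam p1 K1" "is_chirp mu p2 K2" and p: "p1 \<noteq> 0" "p2 \<noteq> 0"
    and h1: "integrable lborel h"
  shows two_sided_measurable: "two_sided K1 K2 h \<in> borel_measurable borel"
    and norm_two_sided_le: "norm (two_sided K1 K2 h y)
        \<le> sqrt \<bar>p1 * p2\<bar> / (2 * pi) * (LINT x|lborel. norm (h x))"
    and two_sided_plancherel: "integrable lborel (\<lambda>x. (norm (h x))\<^sup>2) \<Longrightarrow>
      (\<integral>\<^sup>+y. ennreal ((norm (two_sided K1 K2 h y))\<^sup>2) \<partial>lborel)
        = ennreal (LINT x|lborel. (norm (h x))\<^sup>2)"
proof -
  obtain \<alpha>1 \<beta>1 where [measurable]: "\<alpha>1 \<in> borel_measurable borel" "\<beta>1 \<in> borel_measurable borel"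
    and K1: "K1 = chirp lam p1 \<alpha>1 \<beta>1"
    using K(1) by (auto simp: is_chirp_def)
  obtain \<alpha>2 \<beta>2 where [measurable]: "\<alpha>2 \<in> borel_measurable borel" "\<beta>2 \<in> borel_measurable borel"
    and K2: "K2 = chirp mu p2 \<alpha>2 \<beta>2"
    using K(2) by (auto simp: is_chirp_def)
  have [measurable]: "h \<in> borel_measurable borel" using borel_measurable_integrable[OF h1] by simp
  define h' where "h' x = qcis lam (\<alpha>1 (fst x)) * h x * qcis mu (\<alpha>2 (snd x))" for x
  have [measurable]: "h' \<in> borel_measurable borel" unfolding h'_def by measurable
  have norm_h': "norm (h' x) = norm (h x)" for x
    by (simp add: h'_def norm_mult norm_qcis lam mu)
  have h'1: "integrable lborel h'"
    by (rule Bochner_Integration.integrable_bound[OF h1]) (auto simp: norm_h')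
  define s where "s = sqrt \<bar>p1 * p2\<bar> / (2 * pi)"
  have s: "s = sqrt (\<bar>p1\<bar> / (2 * pi)) * sqrt (\<bar>p2\<bar> / (2 * pi))" and "0 \<le> s"
  proof -
    have "sqrt (\<bar>p1\<bar> / (2 * pi)) * sqrt (\<bar>p2\<bar> / (2 * pi)) = sqrt (\<bar>p1 * p2\<bar> / (2 * pi)\<^sup>2)"
      by (simp only: real_sqrt_mult[symmetric]) (simp add: abs_mult power2_eq_square)
    also have "\<dots> = s"
      unfolding real_sqrt_divide real_sqrt_abs by (simp add: s_def)
    finally show "s = sqrt (\<bar>p1\<bar> / (2 * pi)) * sqrt (\<bar>p2\<bar> / (2 * pi))" ..
  qed (simp add: s_def)
  have eq: "two_sided K1 K2 h y = s *\<^sub>R (qcis lam (\<beta>1 (fst y)) * qft lam mu p1 p2 h' y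
      * qcis mu (\<beta>2 (snd y)))" for y
  proof -
    have int: "integrable lborel (\<lambda>x. qcis lam (p1 * fst x * fst y) * h' x
        * qcis mu (p2 * snd x * snd y))"
      by (rule Bochner_Integration.integrable_bound[OF h1])
        (auto simp: norm_mult norm_qcis lam mu norm_h')
    have "two_sided K1 K2 h y = (LINT x|lborel. s *\<^sub>R (qcis lam (\<beta>1 (fst y)) *
        (qcis lam (p1 * fst x * fst y) * h' x * qcis mu (p2 * snd x * snd y)) * qcis mu (\<beta>2 (snd y))))"
      unfolding two_sided_def
    proof (rule Bochner_Integration.integral_cong[OF refl])
      fix x :: "real \<times> real"
      have "qcis lam (\<alpha>1 (fst x) + \<beta>1 (fst y) + p1 * fst x * fst y)
          = qcis lam (\<beta>1 (fst y)) * qcis lam (p1 * fst x * fst y) * qcis lam (\<alpha>1 (fst x))"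
        unfolding qcis_add[OF lam, symmetric] by (simp add: add_ac)
      moreover have "qcis mu (\<alpha>2 (snd x) + \<beta>2 (snd y) + p2 * snd x * snd y)
          = qcis mu (\<alpha>2 (snd x)) * qcis mu (p2 * snd x * snd y) * qcis mu (\<beta>2 (snd y))"
        unfolding qcis_add[OF mu, symmetric] by (simp add: add_ac)
      ultimately show "K1 (fst x) (fst y) * h x * K2 (snd x) (snd y) = s *\<^sub>R (qcis lam (\<beta>1 (fst y)) *
        (qcis lam (p1 * fst x * fst y) * h' x * qcis mu (p2 * snd x * snd y)) * qcis mu (\<beta>2 (snd y)))"
        by (simp add: K1 K2 chirp_def s h'_def mult.assoc)
    qed
    also have "\<dots> = s *\<^sub>R (qcis lam (\<beta>1 (fst y)) * qft lam mu p1 p2 h' y * qcis mu (\<beta>2 (snd y)))"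
      by (simp add: qft_def int del: mult_scaleR_left mult_scaleR_right)
    finally show ?thesis .
  qed
  have norm_eq: "norm (two_sided K1 K2 h y) = s * norm (qft lam mu p1 p2 h' y)" for y
    unfolding eq using \<open>0 \<le> s\<close> by (simp add: norm_mult norm_qcis lam mu)
  have [measurable]: "qft lam mu p1 p2 h' \<in> borel_measurable borel"
    by (rule qft_measurable[OF lam mu h'1])
  show "two_sided K1 K2 h \<in> borel_measurable borel"
    unfolding eq[abs_def] by measurable
  show "norm (two_sided K1 K2 h y) \<le> sqrt \<bar>p1 * p2\<bar> / (2 * pi) * (LINT x|lborel. norm (h x))"
    unfolding norm_eq s_def[symmetric]
    using norm_qft_le[OF lam mu h'1, of p1 p2 y] \<open>0 \<le> s\<close>
      by (intro mult_left_mono) (simp_all add: norm_h')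
  assume h2: "integrable lborel (\<lambda>x. (norm (h x))\<^sup>2)"
  \<comment> \<open>The kernel normalisation cancels the constant in \<open>qft_plancherel\<close>
    exactly.\<close>
  have s2: "s\<^sup>2 * (4 * pi\<^sup>2 / \<bar>p1 * p2\<bar>) = 1"
    using p by (simp add: s_def power_divide power_mult_distrib)
  have "(\<integral>\<^sup>+y. ennreal ((norm (two_sided K1 K2 h y))\<^sup>2) \<partial>lborel)
      = (\<integral>\<^sup>+y. ennreal (s\<^sup>2) * ennreal ((norm (qft lam mu p1 p2 h' y))\<^sup>2) \<partial>lborel)"
    by (simp add: norm_eq power_mult_distrib ennreal_mult)
  also have "\<dots> = ennreal (s\<^sup>2) * ennreal (4 * pi\<^sup>2 / \<bar>p1 * p2\<bar> * (LINT x|lborel. (norm (h x))\<^sup>2))"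
    using qft_plancherel[OF lam mu h'1 p] h2 by (simp add: nn_integral_cmult norm_h')
  also have "\<dots> = ennreal (s\<^sup>2 * (4 * pi\<^sup>2 / \<bar>p1 * p2\<bar>) * (LINT x|lborel. (norm (h x))\<^sup>2))"
    by (subst ennreal_mult[symmetric]) (auto simp: mult.assoc)
  finally show "(\<integral>\<^sup>+y. ennreal ((norm (two_sided K1 K2 h y))\<^sup>2) \<partial>lborel)
      = ennreal (LINT x|lborel. (norm (h x))\<^sup>2)"
    unfolding s2 by simp
qed

text \<open>Expanding the square gives the norms of \<open>S\<close> and \<open>h\<close> and a
  cross term. Isometry turns the norms into those of the restriction of \<open>F\<close> to
  \<open>B\<close> and of \<open>F\<close>; Fubini shows that the integral of
  \<open>inner (S x) (h x)\<close> is again the squared norm of the restriction. The sum is the mass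
  of \<open>F\<close> outside of \<open>B\<close>.\<close>

lemma two_sided_truncated_inverse:
  assumes lam: "lam\<^sup>2 = -1" and mu: "mu\<^sup>2 = -1"
    and K: "is_chirp lam p1 K1" "is_chirp mu p2 K2" and p: "p1 \<noteq> 0" "p2 \<noteq> 0"
    and h1: "integrable lborel h" and h2: "integrable lborel (\<lambda>x. (norm (h x))\<^sup>2)"
    and B[measurable]: "B \<in> sets borel" and Bfin: "emeasure lborel B < \<infinity>"
  defines "F \<equiv> two_sided K1 K2 h"
  defines "S \<equiv> two_sided (\<lambda>y x. qcnj (K1 x y)) (\<lambda>y x. qcnj (K2 x y)) (\<lambda>y. indicator B y *\<^sub>R F y)"
  shows "(\<integral>\<^sup>+x. ennreal ((norm (S x - h x))\<^sup>2) \<partial>lborel)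
       = (\<integral>\<^sup>+y. ennreal ((norm (F y))\<^sup>2) * indicator (- B) y \<partial>lborel)"
proof -
  let ?K1' = "\<lambda>y x. qcnj (K1 x y)" and ?K2' = "\<lambda>y x. qcnj (K2 x y)"
  let ?FB = "\<lambda>y. indicator B y *\<^sub>R F y"
  note [measurable] = chirp_measurable[OF K(1)] chirp_measurable[OF K(2)]
  have [measurable]: "h \<in> borel_measurable borel" using borel_measurable_integrable[OF h1] by simp
  have [measurable]: "F \<in> borel_measurable borel"
    unfolding F_def by (rule two_sided_measurable[OF lam mu K p h1])
  define C where "C = sqrt \<bar>p1 * p2\<bar> / (2 * pi) * (LINT x|lborel. norm (h x))"
  have FC: "norm (F y) \<le> C" for y
    unfolding F_def C_def by (rule norm_two_sided_le[OF lam mu K p h1])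
  have iB: "integrable lborel (\<lambda>y. c * indicator B y :: real)" for c
    using Bfin by (intro integrable_mult_right) (simp add: integrable_indicator_iff)
  \<comment> \<open>\<open>F\<close> is bounded, so its restriction to a set of finite measure is
    integrable and square integrable, although \<open>F\<close> itself need not be
    integrable.\<close>
  have FB1: "integrable lborel ?FB"
    by (rule Bochner_Integration.integrable_bound[OF iB[of C]])
      (auto simp: order_trans[OF FC] split: split_indicator)
  have FB2: "integrable lborel (\<lambda>y. (norm (?FB y))\<^sup>2)"
    by (rule Bochner_Integration.integrable_bound[OF iB[of "C\<^sup>2"]])
      (auto simp: FC power_mono split: split_indicator)
  note K' = is_chirp_adjoint[OF lam K(1)] is_chirp_adjoint[OF mu K(2)]
  have p': "- p1 \<noteq> 0" "- p2 \<noteq> 0" using p by auto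
  have [measurable]: "S \<in> borel_measurable borel"
    unfolding S_def by (rule two_sided_measurable[OF lam mu K' p' FB1])
  have SB: "(\<integral>\<^sup>+x. ennreal ((norm (S x))\<^sup>2) \<partial>lborel) = ennreal (LINT y|lborel. (norm (?FB y))\<^sup>2)"
    unfolding S_def by (rule two_sided_plancherel[OF lam mu K' p' FB1 FB2])
  have S2: "integrable lborel (\<lambda>x. (norm (S x))\<^sup>2)"
    by (rule integrableI_nonneg) (auto simp: SB)
  have Sint: "(LINT x|lborel. (norm (S x))\<^sup>2) = (LINT y|lborel. (norm (?FB y))\<^sup>2)"
    using SB by (subst (asm) nn_integral_eq_integral[OF S2]) auto
  have FF: "(\<integral>\<^sup>+y. ennreal ((norm (F y))\<^sup>2) \<partial>lborel) = ennreal (LINT x|lborel. (norm (h x))\<^sup>2)"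
    unfolding F_def by (rule two_sided_plancherel[OF lam mu K p h1 h2])
  have F2: "integrable lborel (\<lambda>x. (norm (F x))\<^sup>2)"
    by (rule integrableI_nonneg) (auto simp: FF)
  have Fint: "(LINT x|lborel. (norm (F x))\<^sup>2) = (LINT y|lborel. (norm (h y))\<^sup>2)"
    using FF by (subst (asm) nn_integral_eq_integral[OF F2]) auto
  define s where "s = sqrt (\<bar>p1\<bar> / (2 * pi)) * sqrt (\<bar>p2\<bar> / (2 * pi))"
  have normK: "norm (K1 a b) * norm (K2 c d) = s" for a b c d
    by (simp add: s_def norm_chirp[OF lam K(1)] norm_chirp[OF mu K(2)])
  \<comment> \<open>The integrand of the cross term: integration over \<open>y\<close> yields
    \<open>inner (S x) (h x)\<close>, integration over \<open>x\<close> the squared modulus of the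
    restricted transform.\<close>
  define T where "T x y = inner (qcnj (K1 (fst x) (fst y)) * ?FB y * qcnj (K2 (snd x) (snd y)))
      (h x)" for x y
  have T_eq: "T x y = inner (?FB y) (K1 (fst x) (fst y) * h x * K2 (snd x) (snd y))" for x y
  proof -
    have qq: "qcnj (qcnj q) = q" for q by (simp add: quat_eq_iff)
    have "T x y = inner (qcnj (K1 (fst x) (fst y)) * ?FB y) (h x * K2 (snd x) (snd y))"
      unfolding T_def inner_mult_right_quat[of _ "qcnj _"] qq ..
    also have "\<dots> = inner (?FB y) (K1 (fst x) (fst y) * (h x * K2 (snd x) (snd y)))"
      unfolding inner_mult_left_quat[of "qcnj (K1 _ _)"] qq ..
    finally show ?thesis by (simp only: mult.assoc)
  qed
  have Tint: "integrable (lborel \<Otimes>\<^sub>M lborel) (\<lambda>(x, y). T x y)"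
    unfolding lborel_prod
  proof (rule Bochner_Integration.integrable_bound)
    show "integrable lborel (\<lambda>z. s * (norm (h (fst z)) * norm (?FB (snd z))))"
      by (intro integrable_mult_right integrable_prod_mult integrable_norm h1 FB1)
    show "(\<lambda>(x, y). T x y) \<in> borel_measurable lborel"
      unfolding T_def case_prod_unfold by measurable
    show "AE z in lborel. norm (case z of (x, y) \<Rightarrow> T x y)
        \<le> norm (s * (norm (h (fst z)) * norm (?FB (snd z))))"
    proof (rule AE_I2)
      fix z :: "(real \<times> real) \<times> (real \<times> real)"
      obtain x y where z: "z = (x, y)" by (cases z)
      have "\<bar>T x y\<bar> \<le> norm (?FB y) * norm (K1 (fst x) (fst y) * h x * K2 (snd x) (snd y))"
        unfolding T_eq by (rule Cauchy_Schwarz_ineq2)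
      also have "\<dots> = norm (?FB y) * norm (h x)
          * (norm (K1 (fst x) (fst y)) * norm (K2 (snd x) (snd y)))"
        by (simp add: norm_mult)
      also have "\<dots> = s * (norm (h x) * norm (?FB y))"
        unfolding normK by simp
      finally show "norm (case z of (x, y) \<Rightarrow> T x y)
          \<le> norm (s * (norm (h (fst z)) * norm (?FB (snd z))))"
        unfolding z by (simp only: prod.case fst_conv snd_conv real_norm_def)
    qed
  qed
  have intK: "integrable lborel (\<lambda>x. K1 (fst x) (fst y) * h x * K2 (snd x) (snd y))" for y
  proof (rule Bochner_Integration.integrable_bound[OF
    integrable_mult_right[of s, OF integrable_norm[OF h1]]])
    show "AE x in lborel. norm (K1 (fst x) (fst y) * h x * K2 (snd x) (snd y)) \<le> norm (s * norm (h x))"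
      by (simp add: norm_mult s_def norm_chirp[OF lam K(1)] norm_chirp[OF mu K(2)] abs_mult)
  qed measurable
  have intK': "integrable lborel (\<lambda>y. qcnj (K1 (fst x) (fst y)) * ?FB y
      * qcnj (K2 (snd x) (snd y)))" for x
  proof (rule Bochner_Integration.integrable_bound[OF
    integrable_mult_right[of s, OF integrable_norm[OF FB1]]])
    show "AE y in lborel. norm (qcnj (K1 (fst x) (fst y)) * ?FB y * qcnj (K2 (snd x) (snd y)))
        \<le> norm (s * norm (?FB y))"
      by (simp add: norm_mult s_def norm_chirp[OF lam K(1)] norm_chirp[OF mu K(2)] abs_mult)
  qed measurable
  have FBF: "inner (?FB y) (F y) = (norm (?FB y))\<^sup>2" for y
    by (simp add: power2_norm_eq_inner split: split_indicator)
  have TL: "(LINT y|lborel. T x y) = inner (S x) (h x)" for x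
    unfolding T_def S_def two_sided_def by (rule integral_inner_left[OF intK'])
  have TR: "(LINT x|lborel. T x y) = (norm (?FB y))\<^sup>2" for y
  proof -
    have "(LINT x|lborel. T x y) = inner (?FB y)
        (LINT x|lborel. K1 (fst x) (fst y) * h x * K2 (snd x) (snd y))"
      unfolding T_eq by (rule integral_inner_right[OF intK])
    also have "\<dots> = inner (?FB y) (F y)"
      by (simp add: F_def two_sided_def)
    finally show ?thesis unfolding FBF .
  qed
  have Sh: "integrable lborel (\<lambda>x. inner (S x) (h x))"
    using lborel_pair.integrable_fst'[OF Tint] by (simp add: TL)
  have Shint: "(LINT x|lborel. inner (S x) (h x)) = (LINT y|lborel. (norm (?FB y))\<^sup>2)"
    using lborel_pair.Fubini_integral[OF Tint] by (simp add: TL TR)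
  have eq: "(norm (S x - h x))\<^sup>2 = (norm (S x))\<^sup>2 + (norm (h x))\<^sup>2 - 2 * inner (S x) (h x)" for x
    unfolding power2_norm_eq_inner by (simp add: inner_commute algebra_simps)
  have int_d: "integrable lborel (\<lambda>x. (norm (S x - h x))\<^sup>2)"
    unfolding eq by (intro Bochner_Integration.integrable_diff Bochner_Integration.integrable_add
      integrable_mult_right S2 h2 Sh)
  have split: "(norm (F y))\<^sup>2 * indicator (- B) y = (norm (F y))\<^sup>2 - (norm (?FB y))\<^sup>2" for y
    by (simp split: split_indicator)
  have int_c: "integrable lborel (\<lambda>y. (norm (F y))\<^sup>2 * indicator (- B) y)"
    unfolding split by (intro Bochner_Integration.integrable_diff F2 FB2)
  have "(LINT x|lborel. (norm (S x - h x))\<^sup>2)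
      = (LINT x|lborel. (norm (h x))\<^sup>2) - (LINT y|lborel. (norm (?FB y))\<^sup>2)"
    unfolding eq by (simp add: S2 h2 Sh Sint Shint del: norm_scaleR)
  also have "\<dots> = (LINT y|lborel. (norm (F y))\<^sup>2 * indicator (- B) y)"
    unfolding split by (simp add: F2 FB2 Fint del: norm_scaleR)
  finally have *: "(LINT x|lborel. (norm (S x - h x))\<^sup>2)
      = (LINT y|lborel. (norm (F y))\<^sup>2 * indicator (- B) y)" .
  have "(\<integral>\<^sup>+x. ennreal ((norm (S x - h x))\<^sup>2) \<partial>lborel) = ennreal (LINT x|lborel. (norm (S x - h x))\<^sup>2)"
    by (rule nn_integral_eq_integral[OF int_d]) simp
  also have "\<dots> = (\<integral>\<^sup>+y. ennreal ((norm (F y))\<^sup>2 * indicator (- B) y) \<partial>lborel)"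
    unfolding * by (rule nn_integral_eq_integral[OF int_c, symmetric]) simp
  also have "\<dots> = (\<integral>\<^sup>+y. ennreal ((norm (F y))\<^sup>2) * indicator (- B) y \<partial>lborel)"
    by (intro nn_integral_cong) (simp split: split_indicator)
  finally show ?thesis .
qed

section \<open>Midpoint and lag coordinates\<close>

lemma integrable_lborel_affine:
  fixes f :: "'a::euclidean_space \<Rightarrow> 'b::{banach, second_countable_topology}"
  assumes "integrable lborel f" "c \<noteq> 0"
  shows "integrable lborel (\<lambda>x. f (t + c *\<^sub>R x))"
proof -
  have [measurable]: "f \<in> borel_measurable borel" using borel_measurable_integrable[OF assms(1)] by simp
  have "integrable (density (distr lborel borel (\<lambda>x. t + c *\<^sub>R x)) (\<lambda>_. ennreal (\<bar>c\<bar> ^ DIM('a)))) f"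
    using assms(1) lborel_affine[OF assms(2), of t] by (simp add: ennreal_power)
  then have "integrable lborel (\<lambda>x. \<bar>c\<bar> ^ DIM('a) *\<^sub>R f (t + c *\<^sub>R x))"
    by (subst (asm) integrable_density) (auto simp: integrable_distr_eq)
  then have "integrable lborel (\<lambda>x. (1 / \<bar>c\<bar> ^ DIM('a)) *\<^sub>R (\<bar>c\<bar> ^ DIM('a) *\<^sub>R f (t + c *\<^sub>R x)))"
    by (rule integrable_scaleR_right)
  then show ?thesis using assms(2) by simp
qed

lemma AE_lborel_affine:
  fixes t :: "'a::euclidean_space"
  assumes "AE x in lborel. P x" "c \<noteq> 0"
  shows "AE x in lborel. P (t + c *\<^sub>R x)"
proof -
  obtain N where N: "{x. \<not> P x} \<subseteq> N" "emeasure lborel N = 0" "N \<in> sets lborel"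
    using AE_E[OF assms(1)] by auto
  have [measurable]: "N \<in> sets borel" using N(3) by simp
  have "AE x in lborel. x \<notin> N"
    using N by (intro AE_not_in) (auto simp: null_sets_def)
  then have "AE x in lborel. t + c *\<^sub>R x \<notin> N"
    using assms(2) by (subst (asm) lborel_affine[OF assms(2), of t], subst (asm) AE_density)
      (auto simp: AE_distr_iff)
  then show ?thesis using N(1) by (auto elim!: eventually_mono)
qed

text \<open>The change of variables is a composition of two shears, \<open>v = e + s\<close> for
  fixed \<open>e\<close> and \<open>t = e + s/2\<close> for fixed \<open>s\<close>. Each is a
  translation in one variable, so translation invariance and Tonelli suffice and no determinant
  appears.\<close>

lemma nn_integral_midpoint_lag:
  fixes G :: "'a::euclidean_space \<Rightarrow> 'a \<Rightarrow> ennreal"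
  assumes G: "(\<lambda>z. G (fst z) (snd z)) \<in> borel_measurable borel"
  shows "(\<integral>\<^sup>+p. G ((1/2) *\<^sub>R (fst p + snd p)) (fst p - snd p) \<partial>lborel)
    = (\<integral>\<^sup>+t. \<integral>\<^sup>+s. G t s \<partial>lborel \<partial>lborel)"
proof -
  have Gm [measurable]: "(\<lambda>x. G (a x) (b x)) \<in> borel_measurable M"
    if [measurable]: "a \<in> borel_measurable M" "b \<in> borel_measurable M" for a b and M :: "'c measure"
    using measurable_compose[OF borel_measurable_Pair[OF that] G] by simp
  have "(\<integral>\<^sup>+p. G ((1/2) *\<^sub>R (fst p + snd p)) (fst p - snd p) \<partial>lborel)
    = (\<integral>\<^sup>+p. G ((1/2) *\<^sub>R (fst p + snd p)) (fst p - snd p) \<partial>(lborel \<Otimes>\<^sub>M lborel))"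
    by (simp add: lborel_prod)
  also have "\<dots> = (\<integral>\<^sup>+e. \<integral>\<^sup>+v. G ((1/2) *\<^sub>R (v + e)) (v - e) \<partial>lborel \<partial>lborel)"
    by (subst lborel_pair.nn_integral_snd[symmetric])
      (auto simp: split_beta lborel_prod intro!: Gm borel_measurable_scaleR borel_measurable_add
        borel_measurable_diff)
  also have "\<dots> = (\<integral>\<^sup>+e. \<integral>\<^sup>+s. G (e + (1/2) *\<^sub>R s) s \<partial>lborel \<partial>lborel)"
  proof (rule nn_integral_cong)
    fix e :: 'a
    have "(\<integral>\<^sup>+v. G ((1/2) *\<^sub>R (v + e)) (v - e) \<partial>lborel)
        = (\<integral>\<^sup>+s. G ((1/2) *\<^sub>R ((e + s) + e)) ((e + s) - e) \<partial>lborel)"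
      by (rule nn_integral_lborel_shift[symmetric]) (intro Gm; simp)
    also have "\<dots> = (\<integral>\<^sup>+s. G (e + (1/2) *\<^sub>R s) s \<partial>lborel)"
    proof -
      have "(1/2) *\<^sub>R ((e + s) + e) = e + (1/2) *\<^sub>R s" for s
        by (simp add: algebra_simps flip: scaleR_left_distrib)
      then show ?thesis by (simp only: add_diff_cancel_left')
    qed
    finally show "(\<integral>\<^sup>+v. G ((1/2) *\<^sub>R (v + e)) (v - e) \<partial>lborel)
        = (\<integral>\<^sup>+s. G (e + (1/2) *\<^sub>R s) s \<partial>lborel)" .
  qed
  also have "\<dots> = (\<integral>\<^sup>+s. \<integral>\<^sup>+e. G (e + (1/2) *\<^sub>R s) s \<partial>lborel \<partial>lborel)"
    by (rule lborel_pair.Fubini') (auto simp: case_prod_unfold lborel_prod intro!: Gm)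
  also have "\<dots> = (\<integral>\<^sup>+s. \<integral>\<^sup>+t. G t s \<partial>lborel \<partial>lborel)"
  proof (rule nn_integral_cong)
    fix s :: 'a
    show "(\<integral>\<^sup>+e. G (e + (1/2) *\<^sub>R s) s \<partial>lborel) = (\<integral>\<^sup>+t. G t s \<partial>lborel)"
      using nn_integral_lborel_shift[of "\<lambda>t. G t s" "(1/2) *\<^sub>R s"] by (simp add: add.commute Gm)
  qed
  also have "\<dots> = (\<integral>\<^sup>+t. \<integral>\<^sup>+s. G t s \<partial>lborel \<partial>lborel)"
    by (rule lborel_pair.Fubini'[symmetric]) (auto simp: case_prod_unfold lborel_prod intro!: Gm)
  finally show ?thesis .
qed

section \<open>Passage between Lebesgue and Borel measurable functions\<close>

lemma in_L2_borel_iff: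
  assumes [measurable]: "f \<in> borel_measurable borel"
  shows "in_L2 f \<longleftrightarrow> (\<integral>\<^sup>+x. ennreal ((norm (f x))\<^sup>2) \<partial>lborel) < \<infinity>"
proof -
  have "f \<in> borel_measurable lebesgue"
    using measurable_completion[of f lborel borel] by simp
  then have "in_L2 f \<longleftrightarrow> integrable lborel (\<lambda>x. (norm (f x))\<^sup>2)"
    unfolding in_L2_def by (subst integrable_completion) auto
  also have "\<dots> \<longleftrightarrow> (\<integral>\<^sup>+x. ennreal ((norm (f x))\<^sup>2) \<partial>lborel) < \<infinity>"
    by (simp add: integrable_iff_bounded)
  finally show ?thesis .
qed

lemma L2_norm_borel:
  assumes [measurable]: "f \<in> borel_measurable borel"
  shows "L2_norm f = sqrt (LINT x|lborel. (norm (f x))\<^sup>2)"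
  unfolding L2_norm_def by (subst integral_completion) auto

text \<open>The real-valued statement is applied to each coordinate; finitely many null sets are
  then combined.\<close>

lemma lebesgue_ex_borel_measurable:
  fixes f :: "'a::euclidean_space \<Rightarrow> 'b::euclidean_space"
  assumes "f \<in> borel_measurable lebesgue"
  obtains f' where "f' \<in> borel_measurable borel" "AE x in lborel. f x = f' x"
proof -
  have "\<forall>i\<in>Basis. \<exists>g. g \<in> borel_measurable lborel \<and> (AE x in lborel. inner (f x) i = g x)"
  proof
    fix i :: 'b assume "i \<in> Basis"
    have "(\<lambda>x. inner (f x) i) \<in> borel_measurable lebesgue" using assms by measurable
    from completion_ex_borel_measurable_real[OF this]
    show "\<exists>g. g \<in> borel_measurable lborel \<and> (AE x in lborel. inner (f x) i = g x)" by blast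
  qed
  then obtain g where g: "\<And>i. i \<in> Basis \<Longrightarrow> g i \<in> borel_measurable lborel"
    "\<And>i. i \<in> Basis \<Longrightarrow> AE x in lborel. inner (f x) i = g i x"
    by metis
  show thesis
  proof
    show "(\<lambda>x. \<Sum>i\<in>Basis. g i x *\<^sub>R i) \<in> borel_measurable borel"
      using g(1) by (intro borel_measurable_sum borel_measurable_scaleR) auto
    have "AE x in lborel. \<forall>i\<in>Basis. inner (f x) i = g i x"
      using g(2) by (intro AE_finite_allI) auto
    then show "AE x in lborel. f x = (\<Sum>i\<in>Basis. g i x *\<^sub>R i)"
    proof eventually_elim
      case (elim x)
      then have "(\<Sum>i\<in>Basis. g i x *\<^sub>R i) = (\<Sum>i\<in>Basis. inner (f x) i *\<^sub>R i)"
        by (intro sum.cong) auto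
      then show ?case by (simp add: euclidean_representation)
    qed
  qed
qed

section \<open>Inversion of the Wigner-Ville distribution\<close>

text \<open>Joint measurability in the midpoint and the frequency, needed in order to integrate over
  both with Tonelli.\<close>

lemma two_sided_measurable_param:
  assumes K: "is_chirp lam p1 K1" "is_chirp mu p2 K2"
    and H: "(\<lambda>z. H (fst z) (snd z)) \<in> borel_measurable
        (borel :: ((real \<times> real) \<times> (real \<times> real)) measure)"
  shows "(\<lambda>z. two_sided K1 K2 (H (fst z)) (snd z))
      \<in> borel_measurable (borel :: ((real \<times> real) \<times> (real \<times> real)) measure)"
proof -
  note [measurable] = chirp_measurable[OF K(1)] chirp_measurable[OF K(2)]
  have [measurable]: "(\<lambda>x. H (a x) (b x)) \<in> borel_measurable M"
    if [measurable]: "a \<in> borel_measurable M" "b \<in> borel_measurable M" for a b and M :: "'c measure"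
    using measurable_compose[OF borel_measurable_Pair[OF that] H] by simp
  have "(\<lambda>z. LINT x|lborel. K1 (fst x) (fst (snd z)) * H (fst z) x * K2 (snd x) (snd (snd z)))
      \<in> borel_measurable (lborel :: ((real \<times> real) \<times> (real \<times> real)) measure)"
    by (rule lborel.borel_measurable_lebesgue_integral) (simp add: case_prod_unfold lborel_prod)
  then show ?thesis by (simp add: two_sided_def)
qed

section \<open>Truncated inversion for Borel functions and arbitrary chirp kernels\<close>

context
  fixes lam mu :: quat and p1 p2 :: real and K1 K2 :: "real \<Rightarrow> real \<Rightarrow> quat"
    and f g :: "real \<times> real \<Rightarrow> quat"
  assumes lam: "lam\<^sup>2 = -1" and mu: "mu\<^sup>2 = -1"
    and K: "is_chirp lam p1 K1" "is_chirp mu p2 K2" and p: "p1 \<noteq> 0" "p2 \<noteq> 0"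
    and fm [measurable]: "f \<in> borel_measurable borel" and gm [measurable]: "g \<in> borel_measurable borel"
    and f2: "integrable lborel (\<lambda>x. (norm (f x))\<^sup>2)" and g2: "integrable lborel (\<lambda>x. (norm (g x))\<^sup>2)"
begin

private definition H where "H t s = f (t + (1/2) *\<^sub>R s) * qcnj (g (t - (1/2) *\<^sub>R s))"

private lemma H_meas [measurable]: "(\<lambda>x. H (a x) (b x)) \<in> borel_measurable M"
  if [measurable]: "a \<in> borel_measurable M" "b \<in> borel_measurable M"
  unfolding H_def by measurable

text \<open>A product of two square integrable functions, hence integrable for every
  \<open>t\<close> and not merely for almost every one.\<close>

private lemma H1: "integrable lborel (H t)"
proof (rule Bochner_Integration.integrable_bound)
  have "integrable lborel (\<lambda>s. (norm (f (t + (1/2) *\<^sub>R s)))\<^sup>2)"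
    "integrable lborel (\<lambda>s. (norm (g (t + (-1/2) *\<^sub>R s)))\<^sup>2)"
    using integrable_lborel_affine[OF f2, of "1/2" t] integrable_lborel_affine[OF g2, of "-1/2" t]
      by auto
  then show "integrable lborel (\<lambda>s. (norm (f (t + (1/2) *\<^sub>R s)))\<^sup>2 + (norm (g (t - (1/2) *\<^sub>R s)))\<^sup>2)"
    by (intro Bochner_Integration.integrable_add) auto
  show "AE s in lborel. norm (H t s) \<le> norm
      ((norm (f (t + (1/2) *\<^sub>R s)))\<^sup>2 + (norm (g (t - (1/2) *\<^sub>R s)))\<^sup>2)"
  proof (rule AE_I2)
    fix s
    let ?a = "norm (f (t + (1/2) *\<^sub>R s))" and ?b = "norm (g (t - (1/2) *\<^sub>R s))"
    have "2 * (?a * ?b) \<le> ?a\<^sup>2 + ?b\<^sup>2" "0 \<le> ?a * ?b"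
      using sum_squares_bound[of ?a ?b] by auto
    then have "?a * ?b \<le> ?a\<^sup>2 + ?b\<^sup>2" by linarith
    then show "norm (H t s) \<le> norm (?a\<^sup>2 + ?b\<^sup>2)"
      by (simp add: H_def norm_mult)
  qed
qed measurable

private definition W where "W t = two_sided K1 K2 (H t)"

private lemma W_meas [measurable]: "(\<lambda>x. W (a x) (b x)) \<in> borel_measurable M"
  if [measurable]: "a \<in> borel_measurable M" "b \<in> borel_measurable M"
proof -
  have "(\<lambda>z. W (fst z) (snd z)) \<in> borel_measurable borel"
    unfolding W_def by (rule two_sided_measurable_param[OF K]) measurable
  from measurable_compose[OF borel_measurable_Pair[OF that] this] show ?thesis by simp
qed

private definition J where "J = (\<lambda>(v, e). f v * qcnj (g e))"

private lemma J_meas [measurable]: "J \<in> borel_measurable borel"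
  unfolding J_def case_prod_unfold by measurable

private lemma H_midpoint: "H ((1/2) *\<^sub>R (v + e)) (v - e) = J (v, e)"
proof -
  have "(1/2) *\<^sub>R (v + e) + (1/2) *\<^sub>R (v - e) = v" "(1/2) *\<^sub>R (v + e) - (1/2) *\<^sub>R (v - e) = e"
    by (simp_all add: algebra_simps flip: scaleR_left_distrib)
  then show ?thesis by (simp only: H_def J_def prod.case)
qed

private lemma J2: "(\<integral>\<^sup>+p. ennreal ((norm (J p))\<^sup>2) \<partial>lborel) < \<infinity>"
proof -
  have "integrable lborel (\<lambda>p. (norm (f (fst p)))\<^sup>2 * (norm (g (snd p)))\<^sup>2)"
    by (rule integrable_prod_mult[OF f2 g2])
  then have "integrable lborel (\<lambda>p. (norm (J p))\<^sup>2)"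
    by (simp add: J_def case_prod_unfold norm_mult power_mult_distrib)
  then show ?thesis by (simp add: integrable_iff_bounded)
qed

text \<open>In the coordinates \<open>v\<close>, \<open>e\<close> the double integral of the squared
  modulus is the finite mass of \<open>J\<close>, so the inner integrals are finite for almost every
  \<open>t\<close>.\<close>

private lemma H2: "AE t in lborel. integrable lborel (\<lambda>s. (norm (H t s))\<^sup>2)"
proof -
  have "(\<integral>\<^sup>+t. \<integral>\<^sup>+s. ennreal ((norm (H t s))\<^sup>2) \<partial>lborel \<partial>lborel)
      = (\<integral>\<^sup>+p. ennreal ((norm (J p))\<^sup>2) \<partial>lborel)"
    by (subst nn_integral_midpoint_lag[symmetric]) (auto simp: H_midpoint)
  then have "(\<integral>\<^sup>+t. \<integral>\<^sup>+s. ennreal ((norm (H t s))\<^sup>2) \<partial>lborel \<partial>lborel) \<noteq> \<infinity>"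
    using J2 by auto
  then have "AE t in lborel. (\<integral>\<^sup>+s. ennreal ((norm (H t s))\<^sup>2) \<partial>lborel) \<noteq> \<infinity>"
    by (intro nn_integral_PInf_AE) (auto intro!: lborel.borel_measurable_nn_integral
      simp: case_prod_unfold lborel_prod)
  then show ?thesis
    by eventually_elim (auto simp: integrable_iff_bounded less_top)
qed

private definition Phi where
  "Phi = (\<lambda>(v, e) u. qcnj (K1 (fst v - fst e) (fst u)) * W ((1/2) *\<^sub>R (v + e)) u
      * qcnj (K2 (snd v - snd e) (snd u)))"

private definition S where
  "S R t = two_sided (\<lambda>y x. qcnj (K1 x y)) (\<lambda>y x. qcnj (K2 x y))
      (\<lambda>y. indicator (cball 0 R) y *\<^sub>R W t y)"

private lemma S_meas [measurable]: "(\<lambda>x. S R (a x) (b x)) \<in> borel_measurable M"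
  if [measurable]: "a \<in> borel_measurable M" "b \<in> borel_measurable M"
proof -
  have "(\<lambda>z. S R (fst z) (snd z)) \<in> borel_measurable borel"
    unfolding S_def
    by (rule two_sided_measurable_param[OF is_chirp_adjoint[OF lam K(1)]
      is_chirp_adjoint[OF mu K(2)]]) measurable
  from measurable_compose[OF borel_measurable_Pair[OF that] this] show ?thesis by simp
qed

private lemma Phi_meas [measurable]: "Phi p \<in> borel_measurable borel"
proof -
  note [measurable] = chirp_measurable[OF K(1)] chirp_measurable[OF K(2)]
  show ?thesis unfolding Phi_def case_prod_unfold by measurable
qed

private lemma Phi_integral: "(LINT u:cball 0 R|lebesgue. Phi p u)
    = S R ((1/2) *\<^sub>R (fst p + snd p)) (fst p - snd p)"
proof -
  have "(LINT u:cball 0 R|lebesgue. Phi p u) = (LINT u|lborel. indicator (cball 0 R) u *\<^sub>R Phi p u)"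
    unfolding set_lebesgue_integral_def by (subst integral_completion) auto
  also have "\<dots> = S R ((1/2) *\<^sub>R (fst p + snd p)) (fst p - snd p)"
    by (simp add: S_def two_sided_def Phi_def case_prod_unfold)
  finally show ?thesis .
qed

text \<open>The transform of the integrable function \<open>H t\<close> is bounded and the kernels
  have constant modulus, so the integrand is bounded on the ball, for every
  \<open>p\<close>.\<close>

private lemma Phi_integrable: "set_integrable lebesgue (cball 0 R) (Phi p)"
proof -
  define C where "C = sqrt (\<bar>p1\<bar> / (2 * pi))
      * (sqrt \<bar>p1 * p2\<bar> / (2 * pi) * (LINT x|lborel. norm (H ((1/2) *\<^sub>R (fst p + snd p)) x)))
        * sqrt (\<bar>p2\<bar> / (2 * pi))"
  have "norm (Phi p u) \<le> C" for u
    unfolding Phi_def C_def case_prod_unfold norm_mult norm_qcnj norm_chirp[OF lam K(1)]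
      norm_chirp[OF mu K(2)] W_def
    by (intro mult_left_mono mult_right_mono norm_two_sided_le[OF lam mu K p H1]) auto
  then have "norm (Phi p u) \<le> \<bar>C\<bar>" for u
    using abs_ge_self order_trans by metis
  then have *: "norm (indicator (cball 0 R) u *\<^sub>R Phi p u) \<le> norm (C * indicator (cball 0 R) u)" for u
    by (simp add: indicator_def)
  have "emeasure lborel (cball (0::real \<times> real) R) < \<infinity>"
    using emeasure_bounded_finite[OF bounded_cball] .
  then have "integrable lborel (\<lambda>u. C * indicator (cball (0::real \<times> real) R) u)"
    by (intro integrable_mult_right) (simp add: integrable_indicator_iff)
  then have "integrable lborel (\<lambda>u. indicator (cball 0 R) u *\<^sub>R Phi p u)"
    by (rule Bochner_Integration.integrable_bound) (use * in auto)
  then show ?thesis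
    unfolding set_integrable_def by (subst integrable_completion) auto
qed

text \<open>In midpoint and lag coordinates the error at almost every fixed \<open>t\<close> is
  given by \<open>two_sided_truncated_inverse\<close> for the ball; Tonelli then reassembles the
  integral over both variables.\<close>

private lemma truncation_error:
  "(\<integral>\<^sup>+p. ennreal ((norm (S R ((1/2) *\<^sub>R (fst p + snd p)) (fst p - snd p) - J p))\<^sup>2) \<partial>lborel)
    = (\<integral>\<^sup>+z. ennreal ((norm (W (fst z) (snd z)))\<^sup>2 * indicator (- cball 0 R) (snd z)) \<partial>lborel)"
proof -
  have "(\<integral>\<^sup>+p. ennreal ((norm (S R ((1/2) *\<^sub>R (fst p + snd p)) (fst p - snd p) - J p))\<^sup>2) \<partial>lborel)
    = (\<integral>\<^sup>+p. ennreal ((norm (S R ((1/2) *\<^sub>R (fst p + snd p)) (fst p - snd p)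
        - H ((1/2) *\<^sub>R (fst p + snd p)) (fst p - snd p)))\<^sup>2) \<partial>lborel)"
    by (simp add: H_midpoint)
  also have "\<dots> = (\<integral>\<^sup>+t. \<integral>\<^sup>+s. ennreal ((norm (S R t s - H t s))\<^sup>2) \<partial>lborel \<partial>lborel)"
    by (rule nn_integral_midpoint_lag) measurable
  also have "\<dots> = (\<integral>\<^sup>+t. \<integral>\<^sup>+u. ennreal ((norm (W t u))\<^sup>2 * indicator (- cball 0 R) u) \<partial>lborel \<partial>lborel)"
  proof (rule nn_integral_cong_AE)
    show "AE t in lborel. (\<integral>\<^sup>+s. ennreal ((norm (S R t s - H t s))\<^sup>2) \<partial>lborel)
        = (\<integral>\<^sup>+u. ennreal ((norm (W t u))\<^sup>2 * indicator (- cball 0 R) u) \<partial>lborel)"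
      using H2
    proof eventually_elim
      case (elim t)
      have "(\<integral>\<^sup>+s. ennreal ((norm (S R t s - H t s))\<^sup>2) \<partial>lborel)
          = (\<integral>\<^sup>+u. ennreal ((norm (W t u))\<^sup>2) * indicator (- cball 0 R) u \<partial>lborel)"
        unfolding S_def W_def
        by (rule two_sided_truncated_inverse[OF lam mu K p H1 elim])
          (use emeasure_bounded_finite[OF bounded_cball] in auto)
      also have "\<dots> = (\<integral>\<^sup>+u. ennreal ((norm (W t u))\<^sup>2 * indicator (- cball 0 R) u) \<partial>lborel)"
        by (intro nn_integral_cong) (simp split: split_indicator)
      finally show ?case .
    qed
  qed
  also have "\<dots> = (\<integral>\<^sup>+z. ennreal ((norm (W (fst z) (snd z)))\<^sup>2 * indicator (- cball 0 R) (snd z))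
      \<partial>(lborel \<Otimes>\<^sub>M lborel))"
    by (subst lborel.nn_integral_fst[symmetric]) (auto simp: lborel_prod)
  finally show ?thesis by (simp add: lborel_prod)
qed

text \<open>The squared error is a tail integral of the integrable function
  \<open>(norm (W t u))\<^sup>2\<close>, which tends to 0 by dominated convergence: at each point
  the indicator vanishes once \<open>R\<close> reaches \<open>norm u\<close>.\<close>

lemma wigner_inversion_borel:
  assumes W2: "in_L2 (\<lambda>(t, u). two_sided K1 K2
      (\<lambda>s. f (t + (1/2) *\<^sub>R s) * qcnj (g (t - (1/2) *\<^sub>R s))) u)"
  shows "has_L2_integral (\<lambda>(v, e) u. qcnj (K1 (fst v - fst e) (fst u)) *
      two_sided K1 K2 (\<lambda>s. f ((1/2) *\<^sub>R (v + e) + (1/2) *\<^sub>R s)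
        * qcnj (g ((1/2) *\<^sub>R (v + e) - (1/2) *\<^sub>R s))) u *
      qcnj (K2 (snd v - snd e) (snd u))) (\<lambda>(v, e). f v * qcnj (g e))"
proof -
  have "in_L2 (\<lambda>z. W (fst z) (snd z))"
    using W2 by (simp add: W_def H_def[abs_def] case_prod_unfold)
  then have W2': "integrable lborel (\<lambda>z. (norm (W (fst z) (snd z)))\<^sup>2)"
    by (subst (asm) in_L2_borel_iff) (auto simp: integrable_iff_bounded)
  let ?D = "\<lambda>R p. S R ((1/2) *\<^sub>R (fst p + snd p)) (fst p - snd p) - J p"
  have cut: "integrable lborel (\<lambda>z. (norm (W (fst z) (snd z)))\<^sup>2
      * indicator (- cball 0 R) (snd z))" for R
    by (rule Bochner_Integration.integrable_bound[OF W2']) (auto split: split_indicator)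
  have D: "(\<integral>\<^sup>+p. ennreal ((norm (?D R p))\<^sup>2) \<partial>lborel)
      = ennreal (LINT z|lborel. (norm (W (fst z) (snd z)))\<^sup>2 * indicator (- cball 0 R) (snd z))" for R
    unfolding truncation_error by (rule nn_integral_eq_integral[OF cut]) simp
  have D2: "integrable lborel (\<lambda>p. (norm (?D R p))\<^sup>2)" for R
    by (rule integrableI_nonneg) (auto simp: D)
  have Dint: "(LINT p|lborel. (norm (?D R p))\<^sup>2)
      = (LINT z|lborel. (norm (W (fst z) (snd z)))\<^sup>2 * indicator (- cball 0 R) (snd z))" for R
    using D[of R] by (subst (asm) nn_integral_eq_integral[OF D2]) auto
  have "has_L2_integral Phi J"
    unfolding has_L2_integral_def Phi_integral
  proof (intro conjI allI impI)
    show "in_L2 J"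
      using J2 by (subst in_L2_borel_iff) auto
    show "AE p in lebesgue. set_integrable lebesgue (cball 0 R) (Phi p)" for R
      using Phi_integrable by auto
    show "in_L2 (\<lambda>p. S R ((1/2) *\<^sub>R (fst p + snd p)) (fst p - snd p))" for R
    proof -
      have J2': "integrable lborel (\<lambda>p. (norm (J p))\<^sup>2)"
        using J2 by (simp add: integrable_iff_bounded)
      have "integrable lborel (\<lambda>p. (norm (S R ((1/2) *\<^sub>R (fst p + snd p)) (fst p - snd p)))\<^sup>2)"
      proof (rule Bochner_Integration.integrable_bound)
        show "integrable lborel (\<lambda>p. 3 * ((norm (?D R p))\<^sup>2 + (norm (J p))\<^sup>2))"
          by (intro integrable_mult_right Bochner_Integration.integrable_add D2 J2')
        show "AE p in lborel. norm ((norm (S R ((1/2) *\<^sub>R (fst p + snd p)) (fst p - snd p)))\<^sup>2)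
            \<le> norm (3 * ((norm (?D R p))\<^sup>2 + (norm (J p))\<^sup>2))"
          \<comment> \<open>The truncated integral is the error plus \<open>J\<close>; the third
            summand is taken to be 0.\<close>
          using norm_sum3_sq_le[of "?D R p" "J p" 0 for p] by auto
      qed measurable
      then show ?thesis
        by (subst in_L2_borel_iff) (auto simp: integrable_iff_bounded)
    qed
    have "((\<lambda>R. LINT z|lborel. (norm (W (fst z) (snd z)))\<^sup>2 * indicator (- cball 0 R) (snd z))
        \<longlongrightarrow> (LINT z|(lborel :: ((real \<times> real) \<times> (real \<times> real)) measure). 0)) at_top"
    proof (rule integral_dominated_convergence_at_top[where w="\<lambda>z. (norm (W (fst z) (snd z)))\<^sup>2"])
      show "integrable lborel (\<lambda>z. (norm (W (fst z) (snd z)))\<^sup>2)" by (rule W2')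
      show "\<forall>\<^sub>F R in at_top. AE z in lborel. norm
          ((norm (W (fst z) (snd z)))\<^sup>2 * indicator (- cball 0 R) (snd z))
            \<le> (norm (W (fst z) (snd z)))\<^sup>2"
        by (auto split: split_indicator)
      show "AE z in lborel. ((\<lambda>R. (norm (W (fst z) (snd z)))\<^sup>2 * indicator (- cball 0 R) (snd z))
          \<longlongrightarrow> 0) at_top"
      proof (rule AE_I2)
        fix z :: "(real \<times> real) \<times> (real \<times> real)"
        show "((\<lambda>R. (norm (W (fst z) (snd z)))\<^sup>2 * indicator (- cball 0 R) (snd z)) \<longlongrightarrow> 0) at_top"
          by (intro tendsto_eventually eventually_mono[OF eventually_ge_at_top[of "norm (snd z)"]]) simp
      qed
    qed measurable
    then have "((\<lambda>R. sqrt (LINT p|lborel. (norm (?D R p))\<^sup>2)) \<longlongrightarrow> sqrt 0) at_top"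
      unfolding Dint by (intro tendsto_real_sqrt) simp
    then show "((\<lambda>R. L2_norm (?D R)) \<longlongrightarrow> 0) at_top"
      by (subst L2_norm_borel) auto
  qed
  then show ?thesis
    by (simp add: Phi_def J_def W_def H_def[abs_def])
qed

end

theorem theorem4p4:
  fixes lam mu :: quat and A1 A2 :: olct_param
    and f g :: "real \<times> real \<Rightarrow> quat"
  assumes "lam\<^sup>2 = -1" and "mu\<^sup>2 = -1"
    and "pa A1 * pd A1 - pb A1 * pc A1 = 1" and "pb A1 \<noteq> 0"
    and "pa A2 * pd A2 - pb A2 * pc A2 = 1" and "pb A2 \<noteq> 0"
    and "in_L2 f" and "in_L2 g" and "\<not> (AE x in lebesgue. g x = 0)"
    and "in_L2 (\<lambda>(t, u). wvd_qolct lam mu A1 A2 f g t u)"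
  shows "\<exists>J. has_L2_integral (wvd_inversion_integrand lam mu A1 A2 f g) J \<and>
    (AE v in lebesgue.
       integrable lebesgue (\<lambda>\<epsilon>. J (v, \<epsilon>) * g \<epsilon>) \<and>
       f v = (1 / (L2_norm g)\<^sup>2) *\<^sub>R (LINT \<epsilon>|lebesgue. J (v, \<epsilon>) * g \<epsilon>))"
proof -
  let ?K1 = "olct_kernel lam A1" and ?K2 = "olct_kernel mu A2"
  note lam = assms(1) and mu = assms(2)
  have fm [measurable]: "f \<in> borel_measurable lebesgue" and gm
    [measurable]: "g \<in> borel_measurable lebesgue"
    and f2: "integrable lebesgue (\<lambda>x. (norm (f x))\<^sup>2)"
      and g2: "integrable lebesgue (\<lambda>x. (norm (g x))\<^sup>2)"
    using assms(7,8) by (auto simp: in_L2_def)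
  \<comment> \<open>The analysis above is for Borel functions, so \<open>f\<close> and
    \<open>g\<close> are replaced by Borel representatives.\<close>
  obtain f' where f' [measurable]: "f' \<in> borel_measurable borel" and ff': "AE x in lborel. f x = f' x"
    by (rule lebesgue_ex_borel_measurable[OF fm])
  obtain g' where g' [measurable]: "g' \<in> borel_measurable borel" and gg': "AE x in lborel. g x = g' x"
    by (rule lebesgue_ex_borel_measurable[OF gm])
  have [measurable]: "f' \<in> borel_measurable lebesgue" "g' \<in> borel_measurable lebesgue"
    using measurable_completion[of f' lborel borel] measurable_completion[of g' lborel borel] by auto
  have f'2: "integrable lborel (\<lambda>x. (norm (f' x))\<^sup>2)"
  proof -
    have "integrable lebesgue (\<lambda>x. (norm (f' x))\<^sup>2)"
      by (rule integrable_cong_AE_imp[OF f2]) (use AE_completion[OF ff'] in auto)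
    then show ?thesis by (subst (asm) integrable_completion) auto
  qed
  have g'2: "integrable lborel (\<lambda>x. (norm (g' x))\<^sup>2)"
  proof -
    have "integrable lebesgue (\<lambda>x. (norm (g' x))\<^sup>2)"
      by (rule integrable_cong_AE_imp[OF g2]) (use AE_completion[OF gg'] in auto)
    then show ?thesis by (subst (asm) integrable_completion) auto
  qed
  have K: "is_chirp lam (- 1 / pb A1) ?K1" "is_chirp mu (- 1 / pb A2) ?K2"
    using is_chirp_olct_kernel assms by auto
  note [measurable] = chirp_measurable[OF K(1)] chirp_measurable[OF K(2)]
  \<comment> \<open>Affine maps with nonzero scale preserve null sets, so the replacement leaves the
    distribution unchanged at every \<open>t\<close> and \<open>u\<close>.\<close>
  have W: "wvd_qolct lam mu A1 A2 f g t u
      = two_sided ?K1 ?K2 (\<lambda>s. f' (t + (1/2) *\<^sub>R s) * qcnj (g' (t - (1/2) *\<^sub>R s))) u" for t u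
  proof -
    have ae: "AE s in lborel. f (t + (1/2) *\<^sub>R s) = f' (t + (1/2) *\<^sub>R s)"
      "AE s in lborel. g (t + (-1/2) *\<^sub>R s) = g' (t + (-1/2) *\<^sub>R s)"
      using AE_lborel_affine[OF ff', of "1/2" t] AE_lborel_affine[OF gg', of "-1/2" t] by auto
    let ?I = "\<lambda>s. ?K1 (fst s) (fst u) * (f' (t + (1/2) *\<^sub>R s) * qcnj (g' (t - (1/2) *\<^sub>R s)))
        * ?K2 (snd s) (snd u)"
    have I [measurable]: "?I \<in> borel_measurable borel" by measurable
    have I': "?I \<in> borel_measurable lebesgue" using measurable_completion[of ?I lborel borel] I by simp
    have eq: "AE s in lebesgue. ?I s = ?K1 (fst s) (fst u) * f (t + (1/2) *\<^sub>R s)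
        * qcnj (g (t - (1/2) *\<^sub>R s)) * ?K2 (snd s) (snd u)"
      using AE_completion[OF ae(1)] AE_completion[OF ae(2)] by eventually_elim (simp add: mult.assoc)
    have "wvd_qolct lam mu A1 A2 f g t u = (LINT s|lebesgue. ?I s)"
      unfolding wvd_qolct_def
    proof (rule integral_cong_AE[symmetric, OF I' _ eq])
      show "(\<lambda>s. ?K1 (fst s) (fst u) * f (t + (1/2) *\<^sub>R s) * qcnj (g (t - (1/2) *\<^sub>R s))
          * ?K2 (snd s) (snd u)) \<in> borel_measurable lebesgue"
        by (rule borel_measurable_AE[OF I' eq])
    qed
    also have "\<dots> = (LINT s|lborel. ?I s)"
      by (rule integral_completion) simp
    finally show ?thesis by (simp add: two_sided_def)
  qed
  \<comment> \<open>The limit of the inner integrals, built from the representatives; multiplication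
    by \<open>g\<close> from the right will turn \<open>qcnj (g' e)\<close> into a real
    factor.\<close>
  let ?J = "\<lambda>(v, e). f' v * qcnj (g' e)"
  have "has_L2_integral (wvd_inversion_integrand lam mu A1 A2 f g) ?J"
    unfolding wvd_inversion_integrand_def W
    by (rule wigner_inversion_borel[OF lam mu K _ _ f' g' f'2 g'2])
      (use assms(4,6,10) in \<open>auto simp: W[abs_def]\<close>)
  moreover have "AE v in lebesgue. integrable lebesgue (\<lambda>e. ?J (v, e) * g e) \<and>
       f v = (1 / (L2_norm g)\<^sup>2) *\<^sub>R (LINT e|lebesgue. ?J (v, e) * g e)"
    using AE_completion[OF ff']
  proof eventually_elim
    case (elim v)
    \<comment> \<open>Almost everywhere \<open>g' e\<close> equals \<open>g e\<close>, and
      \<open>qcnj (g e) * g e\<close> is the real number \<open>(norm (g e))\<^sup>2\<close>, which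
      commutes with \<open>f' v\<close>.\<close>
    have eq: "AE e in lebesgue. (norm (g e))\<^sup>2 *\<^sub>R f' v = ?J (v, e) * g e"
      using AE_completion[OF gg']
      by eventually_elim (simp add: mult.assoc mult_qcnj of_real_def)
    have int: "integrable lebesgue (\<lambda>e. (norm (g e))\<^sup>2 *\<^sub>R f' v)"
      using g2 by (rule integrable_scaleR_left)
    have m: "(\<lambda>e. ?J (v, e) * g e) \<in> borel_measurable lebesgue"
      by (rule borel_measurable_AE[OF borel_measurable_integrable[OF int] eq])
    have int': "integrable lebesgue (\<lambda>e. ?J (v, e) * g e)"
      by (rule integrable_cong_AE_imp[OF int m]) (use eq in \<open>auto elim!: eventually_mono\<close>)
    have "(LINT e|lebesgue. ?J (v, e) * g e) = (LINT e|lebesgue. (norm (g e))\<^sup>2 *\<^sub>R f' v)"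
      by (rule integral_cong_AE[symmetric, OF _ m eq]) (rule borel_measurable_integrable[OF int])
    also have "\<dots> = (LINT e|lebesgue. (norm (g e))\<^sup>2) *\<^sub>R f' v"
      using g2 by (rule integral_scaleR_left)
    also have "(LINT e|lebesgue. (norm (g e))\<^sup>2) = (L2_norm g)\<^sup>2"
      by (simp add: L2_norm_def)
    finally have val: "(LINT e|lebesgue. ?J (v, e) * g e) = (L2_norm g)\<^sup>2 *\<^sub>R f' v" .
    \<comment> \<open>A nonnegative integrable function with integral 0 vanishes almost everywhere,
      which is excluded for \<open>g\<close>; hence the division is legitimate.\<close>
    have "(LINT e|lebesgue. (norm (g e))\<^sup>2) \<noteq> 0"
      using assms(9) integral_nonneg_eq_0_iff_AE[OF g2] by auto
    then have "(L2_norm g)\<^sup>2 \<noteq> 0" by (simp add: L2_norm_def)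
    then show ?case using int' val elim by simp
  qed
  ultimately show ?thesis by blast
qed

end
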